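(* Let $X$ be a separable Tychonoff space. Then $A(X)$ is a $k$-space with a $\mathfrak{G}$-base if and only if $X$ is either countable and discrete or a submetrizable $k_{\omega}$-space. *)

theory Defs
  imports "HOL-Analysis.Analysis"
begin

definition tychonoff_space :: "'a topology \<Rightarrow> bool" where
  "tychonoff_space X \<longleftrightarrow> completely_regular_space X \<and> t1_space X"

text \<open>Carrier of the free abelian group A(X): finitely supported integer-valued
  functions on X (formal integer combinations of points of X).\<close>
definition free_ab_carrier :: "'a topology \<Rightarrow> ('a \<Rightarrow> int) set" where
  "free_ab_carrier X = {f. finite {x. f x \<noteq> 0} \<and> {x. f x \<noteq> 0} \<subseteq> topspace X}"

definition free_ab_unit :: "'a \<Rightarrow> ('a \<Rightarrow> int)" where
  "free_ab_unit x = (\<lambda>y. if y = x then 1 else 0)"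

definition free_ab_group_topology :: "'a topology \<Rightarrow> ('a \<Rightarrow> int) topology \<Rightarrow> bool" where
  "free_ab_group_topology X T \<longleftrightarrow>
     topspace T = free_ab_carrier X \<and>
     continuous_map (prod_topology T T) T (\<lambda>(f, g). (\<lambda>x. f x + g x)) \<and>
     continuous_map T T (\<lambda>f. (\<lambda>x. - f x))"

text \<open>Markov free abelian topological group A(X): the finest group topology on the
  free abelian group over X for which the canonical map X \<rightarrow> A(X) is continuous
  (supremum of all such group topologies).\<close>
definition free_abelian_topological_group :: "'a topology \<Rightarrow> ('a \<Rightarrow> int) topology" where
  "free_abelian_topological_group X =
     topology_generated_by
       (\<Union>{{U. openin T U} | T. free_ab_group_topology X T \<and>
                                continuous_map X T free_ab_unit})"

definition has_G_base_at :: "'b topology \<Rightarrow> 'b \<Rightarrow> bool" where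
  "has_G_base_at T x \<longleftrightarrow>
     (\<exists>U :: (nat \<Rightarrow> nat) \<Rightarrow> 'b set.
        (\<forall>\<alpha>. U \<alpha> \<subseteq> topspace T \<and> (\<exists>V. openin T V \<and> x \<in> V \<and> V \<subseteq> U \<alpha>)) \<and>
        (\<forall>W. openin T W \<and> x \<in> W \<longrightarrow> (\<exists>\<alpha>. U \<alpha> \<subseteq> W)) \<and>
        (\<forall>\<alpha> \<beta>. (\<forall>i. \<alpha> i \<le> \<beta> i) \<longrightarrow> U \<beta> \<subseteq> U \<alpha>))"

definition free_ab_has_G_base :: "'a topology \<Rightarrow> bool" where
  "free_ab_has_G_base X \<longleftrightarrow> has_G_base_at (free_abelian_topological_group X) (\<lambda>_. 0)"

definition submetrizable_space :: "'a topology \<Rightarrow> bool" where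
  "submetrizable_space X \<longleftrightarrow>
     (\<exists>T. metrizable_space T \<and> topspace T = topspace X \<and> (\<forall>U. openin T U \<longrightarrow> openin X U))"

definition k_omega_space :: "'a topology \<Rightarrow> bool" where
  "k_omega_space X \<longleftrightarrow>
     (\<exists>K :: nat \<Rightarrow> 'a set.
        (\<forall>n. compactin X (K n)) \<and> (\<forall>n. K n \<subseteq> K (Suc n)) \<and>
        (\<Union>n. K n) = topspace X \<and>
        (\<forall>S. S \<subseteq> topspace X \<longrightarrow>
             (closedin X S \<longleftrightarrow> (\<forall>n. closedin (subtopology X (K n)) (K n \<inter> S)))))"

end

(* A(X) carries enough real functionals: every continuous f on X extends to a continuous
   homomorphism ext f, so for Tychonoff X the group is Hausdorff and X is a closed subspace of it.

   If X is k-omega with compact sets K n, the words of bounded length over the K n form compact sets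
   D n exhausting A(X). The sets whose traces on all D n are relatively open form a group topology
   (by Wallace's lemma), hence coincide with the topology of A(X), which is then k-omega. Countably
   many functionals separate points if X is also separable and submetrizable; their common
   neighbourhoods of 0 give a G-base by choosing a neighbourhood index anew on every D n.

   Conversely let U be a G-base and A(X) a k-space. For P such that every sequence in P returns
   infinitely often to a compact set, the monotonicity of U makes the continuous functions on the
   closure of P separable, so that this closure is compact and metrizable. In particular X is
   sequential. If X is not discrete, some alpha is such that the differences of points of X lying in
   the sets D(alpha|k) (intersections of the U b over all b extending alpha|k) have this property.
   Closing a countable dense set off under translations by these differences gives compact sets
   K n with union X, and any convergent sequence lies in one of them up to finitely many terms. *)
theory Submission
  imports Defs "HOL-Library.Function_Algebras"
begin

section \<open>Abelian topological groups\<close>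

text \<open>The topology of A(X) is a supremum of group topologies about which nothing is known, so
  neighbourhoods of 0 cannot be written down. It is only accessible through its universal property:
  every argument about it exhibits one group topology on the carrier that makes \<open>e\<close>
  continuous.

  For k-omega X the obstacle is addition in the limit topology. A set U is known to be open only on
  each D n, so open V and W with V + W inside U cannot be obtained in one stroke; they are grown as
  unions of compact sets, one D n at a time.

  In the converse, the obstacle is that the index set of a G-base is uncountable. Its order has one
  decisive property: indices b_k that agree with alpha below k have a common upper bound beta,
  because at each coordinate only finitely many of them are unrestricted. A failure for each prefix
  of alpha is thus a failure for the single neighbourhood U beta. This lets the countably many
  finite words replace the functions on the natural numbers. A nontrivial convergent sequence is
  what a non-isolated point contributes: its large multiples keep perturbed elements of A(X)
  apart.\<close>

lemma openin_prod_boxE: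
  assumes "openin (prod_topology S T) W" "(x, y) \<in> W"
  obtains U V where "openin S U" "openin T V" "x \<in> U" "y \<in> V" "U \<times> V \<subseteq> W"
  using openin_prod_topology_alt[THEN iffD1, rule_format, OF assms] by (elim exE conjE) (rule that)

text \<open>The group is the subgroup \<open>topspace T\<close> of the type: for A(X), functions of
  infinite support or with support outside \<open>X\<close> have to be left out.\<close>

locale abelian_group_topology =
  fixes T :: "'g::ab_group_add topology"
  assumes zero_in: "0 \<in> topspace T"
    and add: "continuous_map (prod_topology T T) T (\<lambda>(a, b). a + b)"
    and neg: "continuous_map T T uminus"
begin

lemma continuous_map_plus:
  assumes "continuous_map Y T f" "continuous_map Y T g"
  shows "continuous_map Y T (\<lambda>x. f x + g x)"
proof -
  have "continuous_map Y (prod_topology T T) (\<lambda>x. (f x, g x))"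
    using assms by (simp add: continuous_map_paired)
  from continuous_map_compose[OF this add] show ?thesis by (simp add: o_def)
qed

lemma continuous_map_uminus:
  assumes "continuous_map Y T f" shows "continuous_map Y T (\<lambda>x. - f x)"
  using continuous_map_compose[OF assms neg] by (simp add: o_def)

lemma continuous_map_minus:
  assumes "continuous_map Y T f" "continuous_map Y T g"
  shows "continuous_map Y T (\<lambda>x. f x - g x)"
  using continuous_map_plus[OF assms(1) continuous_map_uminus[OF assms(2)]] by simp

lemma add_in: "a \<in> topspace T \<Longrightarrow> b \<in> topspace T \<Longrightarrow> a + b \<in> topspace T"
  using continuous_map_funspace[OF add] by (auto simp: Pi_iff)

lemma neg_in: "a \<in> topspace T \<Longrightarrow> - a \<in> topspace T"
  using continuous_map_funspace[OF neg] by auto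

lemma diff_in: "a \<in> topspace T \<Longrightarrow> b \<in> topspace T \<Longrightarrow> a - b \<in> topspace T"
  using add_in[of a "-b"] neg_in by simp

lemma continuous_map_add_pair: "continuous_map (prod_topology T T) T (\<lambda>p. fst p + snd p)"
  by (intro continuous_map_plus continuous_map_fst continuous_map_snd)

lemma continuous_map_diff_pair: "continuous_map (prod_topology T T) T (\<lambda>p. fst p - snd p)"
  by (intro continuous_map_minus continuous_map_fst continuous_map_snd)

lemma openin_translation:
  assumes "openin T U" "a \<in> topspace T"
  shows "openin T {b \<in> topspace T. b - a \<in> U}"
proof (rule openin_continuous_map_preimage[OF _ assms(1)])
  show "continuous_map T T (\<lambda>b. b - a)"
    using assms(2) by (intro continuous_map_minus) auto
qed

lemma half_neighbourhood:
  assumes "openin T W" "0 \<in> W"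
  obtains V where "openin T V" "0 \<in> V" "V \<subseteq> W"
    "\<And>a b. a \<in> V \<Longrightarrow> b \<in> V \<Longrightarrow> a + b \<in> W \<and> a - b \<in> W"
proof -
  have "openin (prod_topology T T) {p \<in> topspace (prod_topology T T). fst p + snd p \<in> W}"
    by (rule openin_continuous_map_preimage[OF continuous_map_add_pair assms(1)])
  then obtain V1 V2 where V12: "openin T V1" "openin T V2" "0 \<in> V1" "0 \<in> V2"
    "V1 \<times> V2 \<subseteq> {p \<in> topspace (prod_topology T T). fst p + snd p \<in> W}"
    by (rule openin_prod_boxE) (use zero_in assms(2) in auto)
  have "openin (prod_topology T T) {p \<in> topspace (prod_topology T T). fst p - snd p \<in> W}"
    by (rule openin_continuous_map_preimage[OF continuous_map_diff_pair assms(1)])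
  then obtain V3 V4 where V34: "openin T V3" "openin T V4" "0 \<in> V3" "0 \<in> V4"
    "V3 \<times> V4 \<subseteq> {p \<in> topspace (prod_topology T T). fst p - snd p \<in> W}"
    by (rule openin_prod_boxE) (use zero_in assms(2) in auto)
  show ?thesis
  proof
    show "openin T (V1 \<inter> V2 \<inter> V3 \<inter> V4 \<inter> W)" using V12 V34 assms by blast
  qed (use V12 V34 assms in auto)
qed

lemma compactin_add:
  assumes "compactin T C" "compactin T D"
  shows "compactin T ((\<lambda>p. fst p + snd p) ` (C \<times> D))"
  by (rule image_compactin[OF _ continuous_map_add_pair])
     (use assms in \<open>simp add: compactin_Times\<close>)

lemma compactin_neg: "compactin T C \<Longrightarrow> compactin T (uminus ` C)"
  by (rule image_compactin[OF _ neg])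

end

section \<open>The free abelian topological group\<close>

abbreviation free_top :: "'a topology \<Rightarrow> ('a \<Rightarrow> int) topology" where
  "free_top \<equiv> free_abelian_topological_group"

abbreviation e :: "'a \<Rightarrow> 'a \<Rightarrow> int" where "e \<equiv> free_ab_unit"

lemma e_apply [simp]: "e x x = 1" "x \<noteq> y \<Longrightarrow> e x y = 0"
  by (auto simp: free_ab_unit_def)

lemma inj_e: "inj e"
  by (rule injI) (metis e_apply zero_neq_one)

lemma zero_in_carrier: "0 \<in> free_ab_carrier X"
  by (simp add: free_ab_carrier_def)

lemma add_in_carrier:
  assumes "a \<in> free_ab_carrier X" "b \<in> free_ab_carrier X"
  shows "a + b \<in> free_ab_carrier X"
proof -
  have "{x. (a + b) x \<noteq> 0} \<subseteq> {x. a x \<noteq> 0} \<union> {x. b x \<noteq> 0}" by auto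
  with assms show ?thesis
    unfolding free_ab_carrier_def using finite_subset[of _ "{x. a x \<noteq> 0} \<union> {x. b x \<noteq> 0}"] by blast
qed

lemma neg_in_carrier: "a \<in> free_ab_carrier X \<Longrightarrow> - a \<in> free_ab_carrier X"
  by (simp add: free_ab_carrier_def)

lemma diff_in_carrier:
  "a \<in> free_ab_carrier X \<Longrightarrow> b \<in> free_ab_carrier X \<Longrightarrow> a - b \<in> free_ab_carrier X"
  using add_in_carrier[OF _ neg_in_carrier, of a X b] by simp

lemma e_in_carrier: "x \<in> topspace X \<Longrightarrow> e x \<in> free_ab_carrier X"
  by (auto simp: free_ab_carrier_def free_ab_unit_def)

text \<open>The measure is the word length, the sum of the absolute values of the coefficients;
  removing one letter at a support point lowers it by one.\<close>

lemma carrier_induct [consumes 1, case_names zero plus minus]: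
  assumes "a \<in> free_ab_carrier X" "P 0"
    and plus: "\<And>a x. a \<in> free_ab_carrier X \<Longrightarrow> P a \<Longrightarrow> x \<in> topspace X \<Longrightarrow> P (a + e x)"
    and minus: "\<And>a x. a \<in> free_ab_carrier X \<Longrightarrow> P a \<Longrightarrow> x \<in> topspace X \<Longrightarrow> P (a - e x)"
  shows "P a"
  using assms(1)
proof (induction "\<Sum>x | a x \<noteq> 0. nat \<bar>a x\<bar>" arbitrary: a rule: less_induct)
  case less
  let ?n = "\<lambda>a. \<Sum>x | a x \<noteq> 0. nat \<bar>a x\<bar>"
  show ?case
  proof (cases "a = 0")
    case False
    then obtain x where x: "a x \<noteq> 0" by (metis ext zero_fun_apply)
    define b where "b = a - (\<lambda>y. sgn (a x) * e x y)"
    have bx: "b x = a x - sgn (a x)" and by': "\<And>y. y \<noteq> x \<Longrightarrow> b y = a y"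
      by (auto simp: b_def)
    have fin: "finite {y. a y \<noteq> 0}" and sub: "{y. a y \<noteq> 0} \<subseteq> topspace X"
      using less.prems by (auto simp: free_ab_carrier_def)
    have bsub: "{y. b y \<noteq> 0} \<subseteq> {y. a y \<noteq> 0}"
    proof (clarify)
      fix y assume "b y \<noteq> 0" "a y = 0"
      with by'[of y] x show False by (cases "y = x") auto
    qed
    have bc: "b \<in> free_ab_carrier X"
      unfolding free_ab_carrier_def using bsub fin sub finite_subset by blast
    have "?n b = (\<Sum>y | a y \<noteq> 0. nat \<bar>b y\<bar>)"
      by (rule sum.mono_neutral_left) (use fin bsub in auto)
    also have "\<dots> < ?n a"
    proof (rule sum_strict_mono_ex1)
      show "\<forall>y\<in>{y. a y \<noteq> 0}. nat \<bar>b y\<bar> \<le> nat \<bar>a y\<bar>"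
      proof
        fix y show "nat \<bar>b y\<bar> \<le> nat \<bar>a y\<bar>"
          using bx by'[of y] by (cases "y = x") (auto simp: sgn_if)
      qed
      show "\<exists>y\<in>{y. a y \<noteq> 0}. nat \<bar>b y\<bar> < nat \<bar>a y\<bar>"
        using x bx by (intro bexI[of _ x]) (auto simp: sgn_if)
    qed (fact fin)
    finally have Pb: "P b" using less.hyps bc by blast
    have "x \<in> topspace X" using x sub by auto
    show ?thesis
    proof (cases "a x > 0")
      case True
      then have "a = b + e x" by (simp add: b_def fun_eq_iff)
      with plus[OF bc Pb \<open>x \<in> topspace X\<close>] show ?thesis by simp
    next
      case False
      with x have "a = b - e x" by (simp add: b_def fun_eq_iff)
      with minus[OF bc Pb \<open>x \<in> topspace X\<close>] show ?thesis by simp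
    qed
  qed (use assms(2) in simp)
qed

lemma free_ab_group_topology_iff:
  "free_ab_group_topology X T \<longleftrightarrow> topspace T = free_ab_carrier X \<and> abelian_group_topology T"
proof -
  have "uminus = (\<lambda>(f :: 'a \<Rightarrow> int) x. - f x)"
    "(\<lambda>(f, g). f + g) = (\<lambda>(f :: 'a \<Rightarrow> int, g). (\<lambda>x. f x + g x))"
    by (auto simp: fun_eq_iff)
  then show ?thesis
    unfolding free_ab_group_topology_def abelian_group_topology_def
    using zero_in_carrier[of X] by metis
qed

lemma openin_free_topI:
  assumes "free_ab_group_topology X T" "continuous_map X T e" "openin T U"
  shows "openin (free_top X) U"
  unfolding free_abelian_topological_group_def
  by (rule topology_generated_by_Basis) (use assms in blast)

text \<open>The indiscrete topology, pulled back from a point, is admissible. So the family whose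
  supremum is A(X) is nonempty and covers the whole carrier.\<close>

lemma free_ab_group_topology_indiscrete:
  "\<exists>T. free_ab_group_topology X T \<and> continuous_map X T e"
proof -
  let ?T = "pullback_topology (free_ab_carrier X) (\<lambda>_. ()) (discrete_topology {()})"
  have top: "topspace ?T = free_ab_carrier X" by (auto simp: topspace_pullback_topology)
  have cont: "continuous_map Y ?T f" if "f \<in> topspace Y \<rightarrow> free_ab_carrier X" for Y :: "'z topology" and f
    by (rule continuous_map_pullback') (use that in \<open>auto simp: o_def\<close>)
  have "free_ab_group_topology X ?T"
    unfolding free_ab_group_topology_iff abelian_group_topology_def
    by (intro conjI cont) (auto simp: top zero_in_carrier add_in_carrier neg_in_carrier)
  moreover have "continuous_map X ?T e" by (rule cont) (simp add: e_in_carrier)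
  ultimately show ?thesis by blast
qed

lemma topspace_free_top [simp]: "topspace (free_top X) = free_ab_carrier X"
proof -
  have "\<Union> (\<Union>{{U. openin T U} |T. free_ab_group_topology X T \<and> continuous_map X T e})
      = free_ab_carrier X"
  proof (intro equalityI subsetI)
    fix a assume "a \<in> free_ab_carrier X"
    then show "a \<in> \<Union> (\<Union>{{U. openin T U} |T. free_ab_group_topology X T \<and> continuous_map X T e})"
    proof -
      obtain T where T: "free_ab_group_topology X T" "continuous_map X T e"
        using free_ab_group_topology_indiscrete by blast
      then have "a \<in> topspace T" using \<open>a \<in> free_ab_carrier X\<close> free_ab_group_topology_iff by blast
      with T show ?thesis by (intro UnionI[of "topspace T"] UnionI[of "{U. openin T U}"]) auto
    qed
  next
    fix a assume "a \<in> \<Union> (\<Union>{{U. openin T U} |T. free_ab_group_topology X T \<and> continuous_map X T e})"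
    then show "a \<in> free_ab_carrier X"
      using openin_subset free_ab_group_topology_iff by fastforce
  qed
  then show ?thesis
    by (simp add: free_abelian_topological_group_def)
qed

text \<open>A supremum is the initial topology for the identity maps into its members, so continuity
  is tested in one admissible \<open>T\<close> at a time. This also makes the supremum itself a
  group topology.\<close>

lemma continuous_map_into_free_top:
  assumes "f \<in> topspace Y \<rightarrow> free_ab_carrier X"
    and "\<And>T. free_ab_group_topology X T \<Longrightarrow> continuous_map X T e \<Longrightarrow> continuous_map Y T f"
  shows "continuous_map Y (free_top X) f"
  unfolding free_abelian_topological_group_def
proof (rule continuous_on_generated_topo)
  fix U assume "U \<in> \<Union>{{U. openin T U} |T. free_ab_group_topology X T \<and> continuous_map X T e}"
  then obtain T where "openin T U" "free_ab_group_topology X T" "continuous_map X T e" by blast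
  with assms(2) have "openin Y {x \<in> topspace Y. f x \<in> U}"
    using openin_continuous_map_preimage by blast
  then show "openin Y (f -` U \<inter> topspace Y)" by (simp add: vimage_def Int_def conj_commute)
next
  show "f ` topspace Y \<subseteq> \<Union> (\<Union>{{U. openin T U} |T. free_ab_group_topology X T \<and> continuous_map X T e})"
    using assms(1) topspace_free_top[of X]
    by (auto simp: free_abelian_topological_group_def)
qed

lemma continuous_map_free_top_id:
  assumes "free_ab_group_topology X T" "continuous_map X T e"
  shows "continuous_map (free_top X) T (\<lambda>a. a)"
proof -
  have "topspace T = free_ab_carrier X" using assms(1) by (simp add: free_ab_group_topology_iff)
  moreover have "{a \<in> free_ab_carrier X. a \<in> U} = U" if "openin T U" for U
    using openin_subset[OF that] calculation by auto
  ultimately show ?thesis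
    unfolding continuous_map_def using openin_free_topI[OF assms] by simp
qed

lemma continuous_map_e: "continuous_map X (free_top X) e"
  by (rule continuous_map_into_free_top) (auto simp: e_in_carrier)

lemma abelian_group_topology_free_top: "abelian_group_topology (free_top X)"
proof
  show "0 \<in> topspace (free_top X)" by (simp add: zero_in_carrier)
  show "continuous_map (prod_topology (free_top X) (free_top X)) (free_top X) (\<lambda>(a, b). a + b)"
  proof (rule continuous_map_into_free_top)
    fix T assume T: "free_ab_group_topology X T" "continuous_map X T e"
    note id = continuous_map_free_top_id[OF T]
    interpret abelian_group_topology T using T free_ab_group_topology_iff by blast
    have "continuous_map (prod_topology (free_top X) (free_top X)) T (\<lambda>p. fst p + snd p)"
      using continuous_map_compose[OF continuous_map_fst id]
        continuous_map_compose[OF continuous_map_snd id]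
      by (intro continuous_map_plus) (auto simp: o_def)
    then show "continuous_map (prod_topology (free_top X) (free_top X)) T (\<lambda>(a, b). a + b)"
      by (simp add: case_prod_unfold)
  qed (auto simp: add_in_carrier)
  show "continuous_map (free_top X) (free_top X) uminus"
  proof (rule continuous_map_into_free_top)
    fix T assume T: "free_ab_group_topology X T" "continuous_map X T e"
    interpret abelian_group_topology T using T free_ab_group_topology_iff by blast
    show "continuous_map (free_top X) T uminus"
      using continuous_map_uminus[OF continuous_map_free_top_id[OF T]] .
  qed (auto simp: neg_in_carrier)
qed

section \<open>Extension of real functions to homomorphisms on A(X)\<close>

definition ext :: "('a \<Rightarrow> real) \<Rightarrow> ('a \<Rightarrow> int) \<Rightarrow> real" where
  "ext f a = (\<Sum>x | a x \<noteq> 0. of_int (a x) * f x)"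

lemma ext_superset:
  assumes "finite S" "{x. a x \<noteq> 0} \<subseteq> S"
  shows "ext f a = (\<Sum>x\<in>S. of_int (a x) * f x)"
  unfolding ext_def by (rule sum.mono_neutral_left) (use assms in auto)

lemma ext_zero [simp]: "ext f 0 = 0"
  by (simp add: ext_def)

lemma ext_add:
  assumes "a \<in> free_ab_carrier X" "b \<in> free_ab_carrier X"
  shows "ext f (a + b) = ext f a + ext f b"
proof -
  let ?S = "{x. a x \<noteq> 0} \<union> {x. b x \<noteq> 0}"
  have S: "finite ?S" using assms by (simp add: free_ab_carrier_def)
  have "ext f (a + b) = (\<Sum>x\<in>?S. of_int ((a + b) x) * f x)"
    by (rule ext_superset[OF S]) auto
  also have "\<dots> = (\<Sum>x\<in>?S. of_int (a x) * f x) + (\<Sum>x\<in>?S. of_int (b x) * f x)"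
    unfolding sum.distrib[symmetric] by (rule sum.cong) (auto simp: distrib_right)
  also have "\<dots> = ext f a + ext f b"
    using ext_superset[OF S, of a f] ext_superset[OF S, of b f] by simp
  finally show ?thesis .
qed

lemma ext_neg: "ext f (- a) = - ext f a"
  by (simp add: ext_def sum_negf)

lemma ext_diff:
  assumes "a \<in> free_ab_carrier X" "b \<in> free_ab_carrier X"
  shows "ext f (a - b) = ext f a - ext f b"
  using ext_add[OF assms(1) neg_in_carrier[OF assms(2)], of f] by (simp add: ext_neg)

lemma ext_e [simp]: "ext f (e x) = f x"
proof -
  have "ext f (e x) = (\<Sum>y\<in>{x}. of_int (e x y) * f y)"
    by (rule ext_superset) (auto simp: free_ab_unit_def)
  then show ?thesis by simp
qed

text \<open>Homomorphisms pull group topologies back to group topologies. The pullback of the real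
  line along \<open>ext f\<close> is admissible because \<open>ext f (e x) = f x\<close>, and A(X)
  is finer than every admissible topology.\<close>

lemma continuous_map_ext:
  assumes "continuous_map X euclideanreal f"
  shows "continuous_map (free_top X) euclideanreal (ext f)"
proof -
  let ?T = "pullback_topology (free_ab_carrier X) (ext f) euclideanreal"
  have top: "topspace ?T = free_ab_carrier X" by (auto simp: topspace_pullback_topology)
  have into: "continuous_map Y ?T g"
    if "g \<in> topspace Y \<rightarrow> free_ab_carrier X" "continuous_map Y euclideanreal (\<lambda>y. ext f (g y))"
    for Y :: "'z topology" and g
    by (rule continuous_map_pullback') (use that in \<open>auto simp: o_def\<close>)
  have out: "continuous_map ?T euclideanreal (ext f)"
    using continuous_map_pullback[of euclideanreal euclideanreal id "free_ab_carrier X" "ext f"] by simp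
  have "continuous_map (prod_topology ?T ?T) euclideanreal (\<lambda>p. ext f (fst p + snd p))"
  proof (rule continuous_map_eq)
    show "continuous_map (prod_topology ?T ?T) euclideanreal (\<lambda>p. ext f (fst p) + ext f (snd p))"
      using continuous_map_compose[OF continuous_map_fst out]
        continuous_map_compose[OF continuous_map_snd out]
      by (intro continuous_map_add) (auto simp: o_def)
  qed (auto simp: top ext_add[symmetric])
  moreover have "continuous_map ?T euclideanreal (\<lambda>a. ext f (- a))"
    unfolding ext_neg by (rule continuous_map_minus[OF out])
  ultimately have "free_ab_group_topology X ?T"
    unfolding free_ab_group_topology_iff abelian_group_topology_def
    by (intro conjI into) (auto simp: top zero_in_carrier add_in_carrier neg_in_carrier case_prod_unfold)
  moreover have "continuous_map X ?T e"
    by (rule into) (use assms in \<open>auto simp: e_in_carrier\<close>)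
  ultimately have "continuous_map (free_top X) ?T (\<lambda>a. a)"
    by (rule continuous_map_free_top_id)
  from continuous_map_compose[OF this out] show ?thesis by (simp add: o_def)
qed

section \<open>Group topologies determined by an increasing sequence of compact sets\<close>

text \<open>The intended instance is words of bounded length. Addition raises the index by one, and
  the inductive constructions below climb by this single step.\<close>

locale compact_filtration = abelian_group_topology T
  for T :: "'g::ab_group_add topology" +
  fixes D :: "nat \<Rightarrow> 'g set"
  assumes Hausdorff: "Hausdorff_space T"
    and compactin_D: "compactin T (D n)"
    and zero_in_D: "0 \<in> D n"
    and add_in_D: "a \<in> D n \<Longrightarrow> b \<in> D n \<Longrightarrow> a + b \<in> D (Suc n)"
    and neg_in_D: "a \<in> D n \<Longrightarrow> - a \<in> D n"
    and Union_D: "(\<Union>n. D n) = topspace T"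
begin

definition limit_topology :: "'g topology" where
  "limit_topology =
     topology (\<lambda>U. U \<subseteq> topspace T \<and> (\<forall>n. openin (subtopology T (D n)) (D n \<inter> U)))"

lemma openin_limit_topology:
  "openin limit_topology U \<longleftrightarrow>
     U \<subseteq> topspace T \<and> (\<forall>n. openin (subtopology T (D n)) (D n \<inter> U))"
proof -
  have "istopology (\<lambda>U. U \<subseteq> topspace T \<and> (\<forall>n. openin (subtopology T (D n)) (D n \<inter> U)))"
    unfolding istopology_def
  proof (intro conjI allI impI)
    fix S U n
    assume "S \<subseteq> topspace T \<and> (\<forall>n. openin (subtopology T (D n)) (D n \<inter> S))"
      "U \<subseteq> topspace T \<and> (\<forall>n. openin (subtopology T (D n)) (D n \<inter> U))"
    then have "openin (subtopology T (D n)) ((D n \<inter> S) \<inter> (D n \<inter> U))" by blast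
    then show "openin (subtopology T (D n)) (D n \<inter> (S \<inter> U))"
      by (simp add: Int_assoc Int_left_commute)
  next
    fix \<K> n
    assume "\<forall>K\<in>\<K>. K \<subseteq> topspace T \<and> (\<forall>n. openin (subtopology T (D n)) (D n \<inter> K))"
    then have "openin (subtopology T (D n)) (\<Union>K\<in>\<K>. D n \<inter> K)" by blast
    then show "openin (subtopology T (D n)) (D n \<inter> \<Union>\<K>)" by simp
  qed auto
  then show ?thesis unfolding limit_topology_def by simp
qed

lemma topspace_limit_topology [simp]: "topspace limit_topology = topspace T"
proof
  show "topspace limit_topology \<subseteq> topspace T"
    using openin_limit_topology openin_topspace by blast
  have "openin limit_topology (topspace T)"
    unfolding openin_limit_topology using openin_subtopology_Int2 by blast
  then show "topspace T \<subseteq> topspace limit_topology" by (rule openin_subset)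
qed

lemma openin_limit_topologyI: "openin T U \<Longrightarrow> openin limit_topology U"
  unfolding openin_limit_topology using openin_subset openin_subtopology_Int2 by blast

lemma D_mono: "m \<le> n \<Longrightarrow> D m \<subseteq> D n"
proof (rule lift_Suc_mono_le[of D])
  show "D n \<subseteq> D (Suc n)" for n using add_in_D[OF _ zero_in_D] by fastforce
qed

lemma D_subset: "D n \<subseteq> topspace T"
  using Union_D by blast

lemma step_mono:
  assumes "C \<subseteq> D k" "k \<le> l" "\<exists>G. openin T G \<and> C \<subseteq> G \<and> D l \<inter> G \<subseteq> C'"
  shows "C \<subseteq> C'"
  using assms D_mono[OF assms(2)] by blast

text \<open>The stages \<open>C n\<close> need not be open; it suffices that each contains a
  relative neighbourhood of the one before. On a fixed \<open>D k\<close> their union then agrees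
  with a union of open sets \<open>G n\<close>.\<close>

lemma openin_limit_topology_Union:
  assumes sub: "\<And>n. C n \<subseteq> D (m + n)"
    and step: "\<And>n. \<exists>G. openin T G \<and> C n \<subseteq> G \<and> D (m + Suc n) \<inter> G \<subseteq> C (Suc n)"
  shows "openin limit_topology (\<Union>n. C n)"
proof -
  obtain G where G: "\<And>n. openin T (G n)" "\<And>n. C n \<subseteq> G n"
    "\<And>n. D (m + Suc n) \<inter> G n \<subseteq> C (Suc n)"
    using step by metis
  have "C n \<subseteq> C (Suc n)" for n
    using G(2)[of n] G(3)[of n] sub[of n] D_mono[of "m + n" "m + Suc n"] by auto
  then have C_mono: "C i \<subseteq> C j" if "i \<le> j" for i j
    using that by (rule lift_Suc_mono_le)
  have "openin (subtopology T (D k)) (D k \<inter> (\<Union>n. C n))" for k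
  proof -
    \<comment> \<open>Starting at \<open>n = k\<close> ensures
      \<open>D k \<subseteq> D (m + Suc n)\<close>, so that \<open>G n\<close> cut down to
      \<open>D k\<close> stays inside \<open>C (Suc n)\<close>. The earlier stages are absorbed
      since \<open>C\<close> increases.\<close>
    have "D k \<inter> (\<Union>n. C n) = D k \<inter> (\<Union>n\<in>{k..}. G n)"
    proof (intro equalityI subsetI IntI)
      fix x assume "x \<in> D k \<inter> (\<Union>n. C n)"
      then obtain n where "x \<in> C n" by blast
      then have "x \<in> C (max n k)" using C_mono[of n "max n k"] by auto
      then show "x \<in> (\<Union>n\<in>{k..}. G n)" using G(2)[of "max n k"] by auto
    next
      fix x assume x: "x \<in> D k \<inter> (\<Union>n\<in>{k..}. G n)"
      then obtain n where "n \<ge> k" "x \<in> G n" by blast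
      moreover have "x \<in> D (m + Suc n)" using x D_mono[of k "m + Suc n"] \<open>n \<ge> k\<close> by auto
      ultimately show "x \<in> (\<Union>n. C n)" using G(3) by blast
    qed auto
    moreover have "openin T (\<Union>n\<in>{k..}. G n)" using G(1) by blast
    ultimately show ?thesis by (simp add: openin_subtopology_Int2)
  qed
  moreover have "(\<Union>n. C n) \<subseteq> topspace T" using sub D_subset by blast
  ultimately show ?thesis by (simp add: openin_limit_topology)
qed

text \<open>\<open>D n\<close> is compact Hausdorff, hence normal: a relatively open set around
  \<open>C\<close> with closure inside \<open>V\<close> is interposed, and this closure is
  \<open>C'\<close>. Its compactness allows the construction to be repeated.\<close>

lemma shrink_compact:
  assumes "compactin T C" "C \<subseteq> V" "openin (subtopology T (D n)) V"
  shows "\<exists>C' G. compactin T C' \<and> C' \<subseteq> V \<and> openin T G \<and> C \<subseteq> G \<and> D n \<inter> G \<subseteq> C'"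
proof -
  let ?S = "subtopology T (D n)"
  have comp: "compact_space ?S" using compactin_D by (simp add: compact_space_subtopology)
  have haus: "Hausdorff_space ?S" using Hausdorff by (rule Hausdorff_space_subtopology)
  have V: "V \<subseteq> D n" using assms(3) openin_subset by fastforce
  then have "compactin ?S C" using assms by (simp add: compactin_subtopology)
  then have "closedin ?S C" using haus by (simp add: compactin_imp_closedin)
  then obtain U where U: "openin ?S U" "C \<subseteq> U" "?S closure_of U \<subseteq> V"
    using compact_Hausdorff_or_regular_imp_normal_space[OF comp] haus assms(2,3)
    unfolding normal_space_alt by blast
  obtain G where G: "openin T G" "U = G \<inter> D n" using U(1) by (auto simp: openin_subtopology)
  have "compactin ?S (?S closure_of U)"
    using closedin_compact_space[OF comp] by simp
  then have "compactin T (?S closure_of U)" by (simp add: compactin_subtopology)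
  moreover have "D n \<inter> G \<subseteq> ?S closure_of U"
    using closure_of_subset[of U ?S] openin_subset[OF U(1)] G(2) by blast
  ultimately show ?thesis using U G by blast
qed

text \<open>Addition is restricted to \<open>D (Suc n) \<times> D (Suc n)\<close>, which it maps
  into \<open>D (Suc (Suc n))\<close>, where the trace of \<open>U\<close> is open. Wallace's lemma
  thickens \<open>C \<times> E\<close> to an open box; shrinking its sides to compact sets restores
  the hypotheses one index higher.\<close>

lemma sum_step:
  assumes U: "openin limit_topology U"
    and CE: "compactin T C" "compactin T E" "C \<subseteq> D n" "E \<subseteq> D n"
    and sum: "\<And>c e. c \<in> C \<Longrightarrow> e \<in> E \<Longrightarrow> c + e \<in> U"
  shows "\<exists>C' E'. compactin T C' \<and> compactin T E' \<and> C' \<subseteq> D (Suc n) \<and> E' \<subseteq> D (Suc n)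
    \<and> (\<forall>c\<in>C'. \<forall>e\<in>E'. c + e \<in> U)
    \<and> (\<exists>G. openin T G \<and> C \<subseteq> G \<and> D (Suc n) \<inter> G \<subseteq> C')
    \<and> (\<exists>G. openin T G \<and> E \<subseteq> G \<and> D (Suc n) \<inter> G \<subseteq> E')"
proof -
  let ?S = "subtopology T (D (Suc n))" and ?S' = "subtopology T (D (Suc (Suc n)))"
  have top: "topspace ?S = D (Suc n)" using D_subset by auto
  have sub: "D n \<subseteq> D (Suc n)" by (rule D_mono) simp
  have "continuous_map (prod_topology ?S ?S) T (\<lambda>p. fst p + snd p)"
    using continuous_map_fst[of ?S ?S] continuous_map_snd[of ?S ?S]
    by (intro continuous_map_plus) (auto simp: continuous_map_in_subtopology)
  then have "continuous_map (prod_topology ?S ?S) ?S' (\<lambda>p. fst p + snd p)"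
    by (auto simp: continuous_map_in_subtopology top add_in_D)
  moreover have "openin ?S' (D (Suc (Suc n)) \<inter> U)"
    using U by (simp add: openin_limit_topology)
  ultimately have W: "openin (prod_topology ?S ?S)
    {p \<in> topspace (prod_topology ?S ?S). fst p + snd p \<in> D (Suc (Suc n)) \<inter> U}" (is "openin _ ?W")
    by (rule openin_continuous_map_preimage)
  have CES: "compactin ?S C" "compactin ?S E"
    using CE sub by (auto simp: compactin_subtopology)
  have "C \<times> E \<subseteq> ?W"
  proof (rule subsetI)
    fix p assume "p \<in> C \<times> E"
    then have p: "fst p \<in> C" "snd p \<in> E" by auto
    then have "fst p \<in> D (Suc n)" "snd p \<in> D (Suc n)" using CE sub by auto
    with p show "p \<in> ?W"
      using sum[of "fst p" "snd p"] add_in_D[of "fst p" "Suc n" "snd p"]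
      by (simp add: top mem_Times_iff D_subset[THEN subsetD])
  qed
  from Wallace_theorem_prod_topology[OF CES W this]
  obtain V V' where V: "openin ?S V" "openin ?S V'" "C \<subseteq> V" "E \<subseteq> V'" "V \<times> V' \<subseteq> ?W"
    by blast
  have VD: "V \<subseteq> D (Suc n)" "V' \<subseteq> D (Suc n)"
    using V(1,2) openin_subset top by blast+
  obtain C' G where C': "compactin T C'" "C' \<subseteq> V" "openin T G" "C \<subseteq> G" "D (Suc n) \<inter> G \<subseteq> C'"
    using shrink_compact[OF CE(1) V(3) V(1)] by blast
  obtain E' H where E': "compactin T E'" "E' \<subseteq> V'" "openin T H" "E \<subseteq> H" "D (Suc n) \<inter> H \<subseteq> E'"
    using shrink_compact[OF CE(2) V(4) V(2)] by blast
  have "\<forall>c\<in>C'. \<forall>e\<in>E'. c + e \<in> U" using V(5) C'(2) E'(2) by fastforce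
  then show ?thesis
    using C'(1) E'(1) subset_trans[OF C'(2) VD(1)] subset_trans[OF E'(2) VD(2)]
    by (intro exI[of _ C'] exI[of _ E'] conjI exI[of _ G] exI[of _ H] C' E')
qed

text \<open>Starting from \<open>{x}\<close> and \<open>{y}\<close>, a pair of compact sets is
  thickened once for each index; the unions of the two sequences are the required open sets.\<close>

lemma add_limit_topology:
  assumes U: "openin limit_topology U" and xy: "x \<in> topspace T" "y \<in> topspace T" "x + y \<in> U"
  shows "\<exists>V W. openin limit_topology V \<and> openin limit_topology W \<and> x \<in> V \<and> y \<in> W
    \<and> (\<forall>v\<in>V. \<forall>w\<in>W. v + w \<in> U)"
proof -
  obtain m where m: "x \<in> D m" "y \<in> D m"
  proof -
    obtain i j where "x \<in> D i" "y \<in> D j" using xy Union_D by blast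
    then show ?thesis using that[of "max i j"] D_mono[of i "max i j"] D_mono[of j "max i j"] by auto
  qed
  define P where "P n p \<longleftrightarrow> compactin T (fst p) \<and> compactin T (snd p) \<and> fst p \<subseteq> D (m + n)
    \<and> snd p \<subseteq> D (m + n) \<and> (\<forall>c\<in>fst p. \<forall>e\<in>snd p. c + e \<in> U) \<and> x \<in> fst p \<and> y \<in> snd p"
    for n and p :: "'g set \<times> 'g set"
  define Q where "Q n p q \<longleftrightarrow> (\<exists>G. openin T G \<and> fst p \<subseteq> G \<and> D (m + Suc n) \<inter> G \<subseteq> fst q)
    \<and> (\<exists>G. openin T G \<and> snd p \<subseteq> G \<and> D (m + Suc n) \<inter> G \<subseteq> snd q)"
    for n and p q :: "'g set \<times> 'g set"
  have "\<exists>f. \<forall>n. P n (f n) \<and> Q n (f n) (f (Suc n))"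
  proof (rule dependent_nat_choice)
    have "P 0 ({x}, {y})" using m xy by (simp add: P_def)
    then show "\<exists>p. P 0 p" by blast
  next
    fix p n assume p: "P n p"
    then obtain C' E' where CE': "compactin T C'" "compactin T E'" "C' \<subseteq> D (Suc (m + n))"
      "E' \<subseteq> D (Suc (m + n))" "\<forall>c\<in>C'. \<forall>e\<in>E'. c + e \<in> U"
      "\<exists>G. openin T G \<and> fst p \<subseteq> G \<and> D (Suc (m + n)) \<inter> G \<subseteq> C'"
      "\<exists>G. openin T G \<and> snd p \<subseteq> G \<and> D (Suc (m + n)) \<inter> G \<subseteq> E'"
      using sum_step[OF U, of "fst p" "snd p" "m + n"] unfolding P_def by metis
    have "D (m + n) \<subseteq> D (Suc (m + n))" by (rule D_mono) simp
    with p CE'(6,7) have "x \<in> C'" "y \<in> E'" unfolding P_def by blast+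
    with CE' have "P (Suc n) (C', E') \<and> Q n p (C', E')"
      unfolding P_def Q_def by simp
    then show "\<exists>q. P (Suc n) q \<and> Q n p q" by blast
  qed
  then obtain f where f: "\<And>n. P n (f n)" "\<And>n. Q n (f n) (f (Suc n))" by blast
  have "fst (f n) \<subseteq> fst (f (Suc n)) \<and> snd (f n) \<subseteq> snd (f (Suc n))" for n
    using f(1)[of n] f(2)[of n] step_mono[of "fst (f n)" "m + n" "m + Suc n" "fst (f (Suc n))"]
      step_mono[of "snd (f n)" "m + n" "m + Suc n" "snd (f (Suc n))"] unfolding P_def Q_def by simp
  then have mono: "fst (f n) \<subseteq> fst (f (Suc n))" "snd (f n) \<subseteq> snd (f (Suc n))" for n
    by auto
  show ?thesis
  proof (intro exI conjI ballI)
    show "openin limit_topology (\<Union>n. fst (f n))"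
      by (rule openin_limit_topology_Union[of _ m]) (use f in \<open>auto simp: P_def Q_def\<close>)
    show "openin limit_topology (\<Union>n. snd (f n))"
      by (rule openin_limit_topology_Union[of _ m]) (use f in \<open>auto simp: P_def Q_def\<close>)
    show "x \<in> (\<Union>n. fst (f n))" "y \<in> (\<Union>n. snd (f n))" using f(1) by (auto simp: P_def)
    fix v w assume "v \<in> (\<Union>n. fst (f n))" "w \<in> (\<Union>n. snd (f n))"
    \<comment> \<open>The sums are controlled only within one stage, so both elements are moved to a
      common one.\<close>
    then obtain i j where "v \<in> fst (f i)" "w \<in> snd (f j)" by blast
    then have "v \<in> fst (f (max i j))" "w \<in> snd (f (max i j))"
      using lift_Suc_mono_le[of "\<lambda>n. fst (f n)", OF mono(1), of i "max i j"]
        lift_Suc_mono_le[of "\<lambda>n. snd (f n)", OF mono(2), of j "max i j"] by auto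
    then show "v + w \<in> U" using f(1)[of "max i j"] unfolding P_def by blast
  qed
qed

lemma abelian_group_topology_limit_topology: "abelian_group_topology limit_topology"
proof
  show "0 \<in> topspace limit_topology" using zero_in by simp
  show "continuous_map (prod_topology limit_topology limit_topology) limit_topology (\<lambda>(a, b). a + b)"
    unfolding continuous_map
  proof (intro conjI allI impI)
    show "(\<lambda>(a, b). a + b) ` topspace (prod_topology limit_topology limit_topology)
      \<subseteq> topspace limit_topology"
      by (auto simp: add_in)
    fix U assume U: "openin limit_topology U"
    show "openin (prod_topology limit_topology limit_topology)
      {p \<in> topspace (prod_topology limit_topology limit_topology). (case p of (a, b) \<Rightarrow> a + b) \<in> U}"
      unfolding openin_prod_topology_alt
    proof (intro allI impI)
      fix x y
      assume xy: "(x, y) \<in> {p \<in> topspace (prod_topology limit_topology limit_topology).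
        (case p of (a, b) \<Rightarrow> a + b) \<in> U}"
      then obtain V W where VW: "openin limit_topology V" "openin limit_topology W" "x \<in> V" "y \<in> W"
        "\<forall>v\<in>V. \<forall>w\<in>W. v + w \<in> U"
        using add_limit_topology[OF U, of x y] by auto
      moreover have "V \<subseteq> topspace T" "W \<subseteq> topspace T"
        using VW(1,2) by (simp_all add: openin_limit_topology)
      ultimately show "\<exists>V W. openin limit_topology V \<and> openin limit_topology W \<and> x \<in> V \<and> y \<in> W \<and>
        V \<times> W \<subseteq> {p \<in> topspace (prod_topology limit_topology limit_topology).
          (case p of (a, b) \<Rightarrow> a + b) \<in> U}"
        by (intro exI[of _ V] exI[of _ W]) auto
    qed
  qed
  show "continuous_map limit_topology limit_topology uminus"
    unfolding continuous_map
  proof (intro conjI allI impI)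
    show "uminus ` topspace limit_topology \<subseteq> topspace limit_topology" by (auto simp: neg_in)
    fix U assume U: "openin limit_topology U"
    have "openin (subtopology T (D n)) (D n \<inter> {x \<in> topspace T. - x \<in> U})" for n
    proof -
      have "continuous_map (subtopology T (D n)) (subtopology T (D n)) uminus"
        using continuous_map_from_subtopology[OF neg]
        by (auto simp: continuous_map_in_subtopology neg_in_D)
      moreover have "openin (subtopology T (D n)) (D n \<inter> U)"
        using U by (simp add: openin_limit_topology)
      ultimately have "openin (subtopology T (D n))
        {x \<in> topspace (subtopology T (D n)). - x \<in> D n \<inter> U}"
        by (rule openin_continuous_map_preimage)
      moreover have "{x \<in> topspace (subtopology T (D n)). - x \<in> D n \<inter> U}
        = D n \<inter> {x \<in> topspace T. - x \<in> U}"
        using neg_in_D by auto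
      ultimately show ?thesis by simp
    qed
    then show "openin limit_topology {x \<in> topspace limit_topology. - x \<in> U}"
      by (auto simp: openin_limit_topology)
  qed
qed

text \<open>The identity from \<open>D n\<close>, with the topology induced by \<open>T\<close>,
  into the limit topology is continuous by construction and carries compactness over.\<close>

lemma compactin_limit_topology_D: "compactin limit_topology (D n)"
proof -
  have "continuous_map (subtopology T (D n)) limit_topology (\<lambda>x. x)"
    unfolding continuous_map
  proof (intro conjI allI impI)
    fix U assume U: "openin limit_topology U"
    have "{x \<in> topspace (subtopology T (D n)). x \<in> U} = D n \<inter> U"
      using D_subset by auto
    with U show "openin (subtopology T (D n)) {x \<in> topspace (subtopology T (D n)). x \<in> U}"
      by (simp add: openin_limit_topology)
  qed auto
  moreover have "compactin (subtopology T (D n)) (D n)"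
    using compactin_D by (simp add: compactin_subtopology)
  ultimately have "compactin limit_topology ((\<lambda>x. x) ` D n)" by (intro image_compactin)
  then show ?thesis by simp
qed

lemma k_space_limit_topology: "k_space limit_topology"
  unfolding k_space_open
proof (intro allI impI)
  fix S
  assume S: "S \<subseteq> topspace limit_topology \<and>
    (\<forall>K. compactin limit_topology K \<longrightarrow> openin (subtopology limit_topology K) (K \<inter> S))"
  have "openin (subtopology T (D n)) (D n \<inter> S)" for n
  proof -
    obtain G where "openin limit_topology G" "D n \<inter> S = G \<inter> D n"
      using S compactin_limit_topology_D[of n] by (auto simp: openin_subtopology)
    then show ?thesis by (metis Int_commute openin_limit_topology)
  qed
  with S show "openin limit_topology S" by (simp add: openin_limit_topology)
qed

text \<open>Compactness of \<open>C \<times> (D (Suc n) - U)\<close>, on which the difference of the coordinates avoids \<open>0 = \<Inter>j. M j\<close>,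
  yields a single \<open>j\<close>.\<close>

lemma neighbourhood_step:
  fixes M :: "nat \<Rightarrow> 'g set"
  assumes M: "\<And>j. closedin T (M j)" "\<And>i j. i \<le> j \<Longrightarrow> M j \<subseteq> M i" "(\<Inter>j. M j) = {0}"
    and U: "openin limit_topology U" and C: "compactin T C" "C \<subseteq> U" "C \<subseteq> D n"
  shows "\<exists>C' j. compactin T C' \<and> C' \<subseteq> U \<and> C' \<subseteq> D (Suc n)
    \<and> (\<forall>c\<in>C. \<forall>d\<in>D (Suc n). d - c \<in> M j \<longrightarrow> d \<in> C')"
proof -
  let ?R = "C \<times> (D (Suc n) - U)" and ?TT = "prod_topology T T"
  let ?W = "\<lambda>j. {p \<in> topspace ?TT. snd p - fst p \<in> topspace T - M j}"
  have cont: "continuous_map ?TT T (\<lambda>p. snd p - fst p)"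
    by (intro continuous_map_minus continuous_map_fst continuous_map_snd)
  have "compactin T (D (Suc n) - U)"
  proof -
    have "closedin (subtopology T (D (Suc n))) (topspace (subtopology T (D (Suc n))) - D (Suc n) \<inter> U)"
      by (rule closedin_diff[OF closedin_topspace]) (use U openin_limit_topology in blast)
    moreover have "topspace (subtopology T (D (Suc n))) - D (Suc n) \<inter> U = D (Suc n) - U"
      using D_subset by auto
    ultimately show ?thesis
      using closedin_compact_space compactin_D[of "Suc n"]
      by (metis compact_space_subtopology compactin_subtopology)
  qed
  then have "compactin ?TT ?R" using C by (simp add: compactin_Times)
  moreover have "openin ?TT (?W j)" for j
    by (rule openin_continuous_map_preimage[OF cont]) (use M(1) in blast)
  moreover have "?R \<subseteq> (\<Union>j. ?W j)"
  proof
    fix p assume p: "p \<in> ?R"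
    then have pt: "fst p \<in> topspace T" "snd p \<in> topspace T"
      using C(3) D_subset by (auto simp: subset_iff)
    have "snd p - fst p \<noteq> 0" using p C(2) by auto
    then obtain j where "snd p - fst p \<notin> M j" using M(3) by blast
    then show "p \<in> (\<Union>j. ?W j)" using pt diff_in by (auto simp: mem_Times_iff)
  qed
  ultimately obtain F where F: "finite F" "F \<subseteq> range ?W" "?R \<subseteq> \<Union>F"
    unfolding compactin_def by (metis (no_types, lifting) imageE)
  obtain J where J: "finite J" "F = ?W ` J" using finite_subset_image[OF F(1,2)] by blast
  obtain j where j: "\<And>i. i \<in> J \<Longrightarrow> i \<le> j" using finite_nat_set_iff_bounded_le[THEN iffD1, OF J(1)] by auto
  have R: "snd p - fst p \<notin> M j" if p: "p \<in> ?R" for p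
  proof -
    obtain i where "i \<in> J" "p \<in> ?W i" using F(3) J(2) p by blast
    with M(2)[OF j[OF \<open>i \<in> J\<close>]] show ?thesis by blast
  qed
  \<comment> \<open>The new stage is the projection of the pairs with difference in
    \<open>M j\<close>. Closedness of \<open>M j\<close> makes it compact, the choice of
    \<open>j\<close> keeps it inside \<open>U\<close>.\<close>
  let ?Z = "(C \<times> D (Suc n)) \<inter> {p \<in> topspace ?TT. snd p - fst p \<in> M j}"
  have "compactin ?TT ?Z"
    by (rule compact_Int_closedin)
       (use C compactin_D closedin_continuous_map_preimage[OF cont M(1)] in \<open>auto simp: compactin_Times\<close>)
  then have "compactin T (snd ` ?Z)" using continuous_map_snd by (rule image_compactin)
  moreover have "snd ` ?Z \<subseteq> U"
  proof
    fix d assume "d \<in> snd ` ?Z"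
    then obtain c where "c \<in> C" "d \<in> D (Suc n)" "d - c \<in> M j" by auto
    then show "d \<in> U" using R[of "(c, d)"] by auto
  qed
  moreover have "snd ` ?Z \<subseteq> D (Suc n)" by auto
  moreover have "d \<in> snd ` ?Z" if "c \<in> C" "d \<in> D (Suc n)" "d - c \<in> M j" for c d
    by (rule image_eqI[of _ _ "(c, d)"]) (use that C(3) D_subset in auto)
  ultimately show ?thesis by blast
qed

section \<open>A G-base for the limit topology\<close>

primrec G_neighbourhood :: "(nat \<Rightarrow> 'g set) \<Rightarrow> (nat \<Rightarrow> nat) \<Rightarrow> nat \<Rightarrow> 'g set" where
  "G_neighbourhood N \<alpha> 0 = {0}"
| "G_neighbourhood N \<alpha> (Suc n) =
    {d \<in> D (Suc n). \<exists>c\<in>G_neighbourhood N \<alpha> n. d - c \<in> N (\<alpha> n)}"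

text \<open>Two families occur because openness of the sets \<open>U \<alpha>\<close> comes from the
  open \<open>N j\<close>, while smallness comes from compactness and needs the closed
  \<open>M j\<close> shrinking to \<open>{0}\<close>. Given \<open>W\<close>,
  \<open>neighbourhood_step\<close> supplies compact stages inside \<open>W\<close> with one index
  per stage; these indices form \<open>\<alpha>\<close>.\<close>

lemma has_G_base_limit_topology:
  fixes M N :: "nat \<Rightarrow> 'g set"
  assumes M: "\<And>j. closedin T (M j)" "\<And>i j. i \<le> j \<Longrightarrow> M j \<subseteq> M i" "(\<Inter>j. M j) = {0}"
    and N: "\<And>j. openin T (N j)" "\<And>i j. i \<le> j \<Longrightarrow> N j \<subseteq> N i" "\<And>j. 0 \<in> N j" "\<And>j. N j \<subseteq> M j"
  shows "has_G_base_at limit_topology 0"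
proof -
  let ?O = "G_neighbourhood N"
  define U where "U \<alpha> = (\<Union>n. ?O \<alpha> n)" for \<alpha>
  have OD: "?O \<alpha> n \<subseteq> D n" for \<alpha> n by (cases n) (auto simp: zero_in_D)
  have open_U: "openin limit_topology (U \<alpha>)" for \<alpha>
    unfolding U_def
  proof (rule openin_limit_topology_Union[of _ 0])
    fix n
    let ?G = "\<Union>c\<in>?O \<alpha> n. {d \<in> topspace T. d - c \<in> N (\<alpha> n)}"
    have "openin T ?G"
      using openin_translation[OF N(1)] OD D_subset by blast
    moreover have "?O \<alpha> n \<subseteq> ?G"
    proof
      fix c assume c: "c \<in> ?O \<alpha> n"
      then have "c \<in> topspace T" using OD[of \<alpha> n] D_subset[of n] by blast
      with c show "c \<in> ?G" using N(3) by (intro UN_I[of c]) auto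
    qed
    moreover have "D (0 + Suc n) \<inter> ?G \<subseteq> ?O \<alpha> (Suc n)" by auto
    ultimately show "\<exists>G. openin T G \<and> ?O \<alpha> n \<subseteq> G \<and> D (0 + Suc n) \<inter> G \<subseteq> ?O \<alpha> (Suc n)"
      by blast
  qed (use OD in simp)
  have zero_U: "0 \<in> U \<alpha>" for \<alpha> unfolding U_def by (rule UN_I[of 0]) auto
  have mono_U: "U \<beta> \<subseteq> U \<alpha>" if "\<forall>i. \<alpha> i \<le> \<beta> i" for \<alpha> \<beta>
  proof -
    have "?O \<beta> n \<subseteq> ?O \<alpha> n" for n
    proof (induction n)
      case (Suc n)
      then show ?case using N(2)[of "\<alpha> n" "\<beta> n"] that by auto
    qed simp
    then show ?thesis unfolding U_def by blast
  qed
  have base_U: "\<exists>\<alpha>. U \<alpha> \<subseteq> W" if W: "openin limit_topology W" "0 \<in> W" for W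
  proof -
    define P where "P n C \<longleftrightarrow> compactin T C \<and> C \<subseteq> W \<and> C \<subseteq> D n" for n C
    define Q where "Q n C C' \<longleftrightarrow> (\<exists>j. \<forall>c\<in>C. \<forall>d\<in>D (Suc n). d - c \<in> M j \<longrightarrow> d \<in> C')" for n C C'
    \<comment> \<open>The clause for \<open>n = 0\<close> pins the first stage to
      \<open>{0}\<close>, where the sets \<open>?O \<alpha>\<close> start.\<close>
    have "\<exists>f. \<forall>n. (P n (f n) \<and> (n = 0 \<longrightarrow> f n = {0})) \<and> Q n (f n) (f (Suc n))"
    proof (rule dependent_nat_choice)
      have "P 0 {0}" using W(2) zero_in_D zero_in by (simp add: P_def)
      then show "\<exists>C. P 0 C \<and> (0 = (0::nat) \<longrightarrow> C = {0})" by blast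
    next
      fix C n assume "P n C \<and> (n = 0 \<longrightarrow> C = {0})"
      then have "compactin T C" "C \<subseteq> W" "C \<subseteq> D n" by (auto simp: P_def)
      from neighbourhood_step[OF M W(1) this]
      show "\<exists>C'. (P (Suc n) C' \<and> (Suc n = 0 \<longrightarrow> C' = {0})) \<and> Q n C C'"
        unfolding P_def Q_def by blast
    qed
    then obtain f where f: "\<And>n. P n (f n)" "f 0 = {0}" "\<And>n. Q n (f n) (f (Suc n))" by blast
    then obtain \<alpha> where \<alpha>: "\<And>n c d. c \<in> f n \<Longrightarrow> d \<in> D (Suc n) \<Longrightarrow> d - c \<in> M (\<alpha> n) \<Longrightarrow> d \<in> f (Suc n)"
      unfolding Q_def by metis
    have "?O \<alpha> n \<subseteq> f n" for n
    proof (induction n)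
      case (Suc n)
      show ?case
      proof
        fix d assume "d \<in> ?O \<alpha> (Suc n)"
        then obtain c where "d \<in> D (Suc n)" "c \<in> ?O \<alpha> n" "d - c \<in> N (\<alpha> n)" by auto
        then show "d \<in> f (Suc n)" using \<alpha>[of c n d] Suc N(4)[of "\<alpha> n"] by blast
      qed
    qed (simp add: f(2))
    then show ?thesis unfolding U_def using f(1) unfolding P_def by blast
  qed
  show ?thesis
    unfolding has_G_base_at_def
  proof (intro exI[of _ U] conjI allI impI)
    fix \<alpha>
    show "U \<alpha> \<subseteq> topspace limit_topology" using open_U by (rule openin_subset)
    show "\<exists>V. openin limit_topology V \<and> 0 \<in> V \<and> V \<subseteq> U \<alpha>" using open_U zero_U by blast
  qed (use base_U mono_U in blast)+
qed

end

section \<open>Separation by real functions\<close>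

lemma tychonoff_separate:
  assumes "tychonoff_space X" "closedin X S" "x \<in> topspace X" "x \<notin> S"
  obtains f :: "'a \<Rightarrow> real" where "continuous_map X euclideanreal f"
    "\<And>y. y \<in> topspace X \<Longrightarrow> f y \<in> {0..1}" "f x = 1" "\<And>y. y \<in> S \<Longrightarrow> f y = 0"
proof -
  obtain g :: "'a \<Rightarrow> real" where g: "continuous_map X (top_of_set {0..1}) g" "g x = 0" "g ` S \<subseteq> {1}"
    using assms unfolding tychonoff_space_def completely_regular_space_def by (metis DiffI)
  have gc: "continuous_map X euclideanreal g" and gr: "\<And>y. y \<in> topspace X \<Longrightarrow> g y \<in> {0..1}"
    using g(1) by (auto simp: continuous_map_in_subtopology)
  show ?thesis
  proof (rule that[of "\<lambda>y. 1 - g y"])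
    show "continuous_map X euclideanreal (\<lambda>y. 1 - g y)"
      by (intro continuous_map_diff gc) simp
  qed (use g gr in auto)
qed

lemma tychonoff_closedin_finite:
  assumes "tychonoff_space X" "finite S" "S \<subseteq> topspace X"
  shows "closedin X S"
  using assms t1_space_closedin_finite[of X] unfolding tychonoff_space_def by blast

lemma ext_eq_single:
  assumes "a \<in> free_ab_carrier X" "\<And>y. a y \<noteq> 0 \<Longrightarrow> y \<noteq> x \<Longrightarrow> f y = 0"
  shows "ext f a = of_int (a x) * f x"
proof -
  have "ext f a = (\<Sum>y\<in>insert x {y. a y \<noteq> 0}. of_int (a y) * f y)"
    by (rule ext_superset) (use assms(1) in \<open>auto simp: free_ab_carrier_def\<close>)
  also have "\<dots> = (\<Sum>y\<in>{x}. of_int (a y) * f y)"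
    by (rule sum.mono_neutral_right) (use assms in \<open>auto simp: free_ab_carrier_def\<close>)
  finally show ?thesis by simp
qed

text \<open>The other support points form a finite, hence closed, set on which \<open>f\<close> is
  made to vanish; only the coefficient at \<open>x\<close> survives in
  \<open>ext f a\<close>.\<close>

lemma tychonoff_separate_coefficient:
  assumes "tychonoff_space X" "a \<in> free_ab_carrier X" "x \<in> topspace X"
  obtains f :: "'a \<Rightarrow> real" where "continuous_map X euclideanreal f"
    "\<And>y. y \<in> topspace X \<Longrightarrow> f y \<in> {0..1}" "f x = 1" "ext f a = of_int (a x)"
proof -
  let ?S = "{y. a y \<noteq> 0} - {x}"
  have "closedin X ?S"
    by (rule tychonoff_closedin_finite) (use assms in \<open>auto simp: free_ab_carrier_def\<close>)
  then obtain f :: "'a \<Rightarrow> real" where f: "continuous_map X euclideanreal f"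
    "\<And>y. y \<in> topspace X \<Longrightarrow> f y \<in> {0..1}" "f x = 1" "\<And>y. y \<in> ?S \<Longrightarrow> f y = 0"
    using tychonoff_separate[OF assms(1) _ assms(3), of ?S] by blast
  moreover have "ext f a = of_int (a x)"
    using ext_eq_single[OF assms(2), of x f] f(3,4) by simp
  ultimately show ?thesis using that by blast
qed

lemma Hausdorff_space_free_top:
  assumes "tychonoff_space X"
  shows "Hausdorff_space (free_top X)"
  unfolding Hausdorff_space_def
proof (intro allI impI)
  fix a b assume ab: "a \<in> topspace (free_top X) \<and> b \<in> topspace (free_top X) \<and> a \<noteq> b"
  then have c: "a \<in> free_ab_carrier X" "b \<in> free_ab_carrier X" "a - b \<in> free_ab_carrier X"
    by (auto simp: diff_in_carrier)
  obtain x where x: "(a - b) x \<noteq> 0" using ab by (metis eq_iff_diff_eq_0 ext zero_fun_apply)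
  with c have "x \<in> topspace X" by (auto simp: free_ab_carrier_def)
  then obtain f :: "'a \<Rightarrow> real" where f: "continuous_map X euclideanreal f" "ext f (a - b) = of_int ((a - b) x)"
    using tychonoff_separate_coefficient[OF assms c(3)] by metis
  then have "ext f a \<noteq> ext f b" using x ext_diff[OF c(1,2), of f] by auto
  then obtain U V where UV: "open U" "open V" "ext f a \<in> U" "ext f b \<in> V" "U \<inter> V = {}"
    using hausdorff[of "ext f a" "ext f b"] by blast
  let ?P = "\<lambda>W. {c \<in> topspace (free_top X). ext f c \<in> W}"
  have "openin (free_top X) (?P U)" "openin (free_top X) (?P V)"
    using openin_continuous_map_preimage[OF continuous_map_ext[OF f(1)]] UV by auto
  moreover have "disjnt (?P U) (?P V)" using UV(5) by (auto simp: disjnt_def)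
  ultimately show "\<exists>U V. openin (free_top X) U \<and> openin (free_top X) V \<and> a \<in> U \<and> b \<in> V \<and> disjnt U V"
    using UV ab by (intro exI[of _ "?P U"] exI[of _ "?P V"]) simp
qed

text \<open>Tents of rational width around the points of a countable dense set: one that is narrow
  compared with the distances from a support point \<open>x\<close> of \<open>a\<close> to the
  others sees only \<open>x\<close>. Balls of the metric are open in \<open>X\<close>, so the dense
  set meets them.\<close>

lemma countable_separating_family:
  assumes "separable_space X" "submetrizable_space X"
  obtains h :: "nat \<Rightarrow> 'a \<Rightarrow> real" where "\<And>n. continuous_map X euclideanreal (h n)"
    "\<And>a. a \<in> free_ab_carrier X \<Longrightarrow> (\<And>n. ext (h n) a = 0) \<Longrightarrow> a = 0"
proof -
  obtain T where T: "metrizable_space T" "topspace T = topspace X" "\<And>U. openin T U \<Longrightarrow> openin X U"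
    using assms(2) unfolding submetrizable_space_def by blast
  obtain M d where "Metric_space M d" and Td: "T = Metric_space.mtopology M d"
    using T(1) unfolding metrizable_space_def by blast
  interpret Metric_space M d by fact
  have MX: "M = topspace X" using T(2) Td by simp
  obtain C where C: "countable C" "C \<subseteq> topspace X" "X closure_of C = topspace X"
    using assms(1) unfolding separable_space_def by blast
  define f where "f p = (\<lambda>x. max 0 (of_rat (snd p) - d x (fst p)))" for p :: "'a \<times> rat"
  \<comment> \<open>The zero function keeps \<open>F\<close> nonempty when \<open>C\<close> is
    empty, as an enumeration requires.\<close>
  define F where "F = insert (\<lambda>_. 0) (f ` (C \<times> UNIV))"
  have F: "countable F" "F \<noteq> {}" using C(1) by (auto simp: F_def)
  define h where "h = from_nat_into F"
  have "range h = F" unfolding h_def using F by (simp add: range_from_nat_into)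
  have cont: "continuous_map X euclideanreal (h n)" for n
  proof -
    have "continuous_map X mtopology (\<lambda>x. x)"
      using topology_finer_continuous_id[of mtopology X] T(2,3) Td by (simp add: id_def)
    then have "continuous_map X euclideanreal (\<lambda>x. d x q)" if "q \<in> C" for q
    proof -
      have "q \<in> M" using that C(2) MX by blast
      then show ?thesis
        using continuous_map_mdist[of X Self "\<lambda>x. x" "\<lambda>_. q"]
          \<open>continuous_map X mtopology (\<lambda>x. x)\<close>
        by (simp add: mtopology_of_def)
    qed
    then have "continuous_map X euclideanreal (f p)" if "fst p \<in> C" for p
      unfolding f_def using that by (intro continuous_map_real_max continuous_map_diff) auto
    moreover have "h n \<in> F" using \<open>range h = F\<close> by blast
    ultimately show ?thesis by (auto simp: F_def)
  qed
  have sep: "a = 0" if a: "a \<in> free_ab_carrier X" "\<And>n. ext (h n) a = 0" for a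
  proof (rule ccontr)
    assume "a \<noteq> 0"
    then obtain x where x: "a x \<noteq> 0" by (metis ext zero_fun_apply)
    have S: "finite {y. a y \<noteq> 0}" "{y. a y \<noteq> 0} \<subseteq> M" using a(1) MX by (auto simp: free_ab_carrier_def)
    \<comment> \<open>The entry \<open>1\<close> is the default when \<open>x\<close> is the only
      support point.\<close>
    define \<delta> where "\<delta> = Min (insert 1 (d x ` ({y. a y \<noteq> 0} - {x})))"
    have "0 < d x y" if "a y \<noteq> 0" "y \<noteq> x" for y
      by (rule mdist_pos_less) (use S x that in auto)
    then have "\<delta> > 0" unfolding \<delta>_def using S by (subst Min_gr_iff) auto
    have \<delta>: "\<delta> \<le> d x y" if "a y \<noteq> 0" "y \<noteq> x" for y
      unfolding \<delta>_def by (rule Min_le) (use S that in auto)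
    \<comment> \<open>If \<open>q\<close> is within \<open>r < \<delta> / 2\<close> of
      \<open>x\<close>, every other support point is further than \<open>r\<close> from
      \<open>q\<close>, so the tent at \<open>q\<close> vanishes there.\<close>
    obtain r where r: "(0::real) < of_rat r" "of_rat r < \<delta> / 2"
      using of_rat_dense[of 0 "\<delta> / 2"] \<open>\<delta> > 0\<close> by (metis half_gt_zero)
    have "openin X (mball x (of_rat r))" using T(3) Td openin_mball by blast
    moreover have "x \<in> X closure_of C" using C(3) S(2) x MX by auto
    moreover have "x \<in> mball x (of_rat r)" using r S(2) x by auto
    ultimately obtain q where q: "q \<in> C" "q \<in> mball x (of_rat r)"
      unfolding in_closure_of by blast
    have "ext (f (q, r)) a = of_int (a x) * f (q, r) x"
    proof (rule ext_eq_single[OF a(1)])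
      fix y assume y: "a y \<noteq> 0" "y \<noteq> x"
      have "d x y \<le> d x q + d q y" by (rule triangle) (use S x y q in auto)
      with \<delta>[OF y] q(2) r show "f (q, r) y = 0" by (simp add: f_def commute)
    qed
    moreover have "f (q, r) x > 0" using q(2) by (simp add: f_def)
    ultimately have "ext (f (q, r)) a \<noteq> 0" using x by simp
    moreover have "f (q, r) \<in> range h" using \<open>range h = F\<close> q(1) by (simp add: F_def)
    ultimately show False using a(2) by (metis imageE)
  qed
  show ?thesis by (rule that[of h, OF cont sep])
qed

section \<open>Submetrizable k-omega spaces\<close>

text \<open>Doubling the previous set gives the law \<open>add_in_D\<close> of
  \<open>compact_filtration\<close>; the extra letter, possibly \<open>0\<close>, brings in the
  points of \<open>K n\<close> and their negatives.\<close>

primrec word_set :: "(nat \<Rightarrow> 'a set) \<Rightarrow> nat \<Rightarrow> ('a \<Rightarrow> int) set" where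
  "word_set K 0 = {0}"
| "word_set K (Suc n) =
    (\<lambda>p. fst p + snd p) ` (((\<lambda>p. fst p + snd p) ` (word_set K n \<times> word_set K n))
      \<times> insert 0 (e ` K n \<union> uminus ` e ` K n))"

declare word_set.simps(2) [simp del]

lemma word_set_SucI:
  "a \<in> word_set K n \<Longrightarrow> b \<in> word_set K n \<Longrightarrow> c \<in> insert 0 (e ` K n \<union> uminus ` e ` K n)
    \<Longrightarrow> a + b + c \<in> word_set K (Suc n)"
  unfolding word_set.simps(2)
  by (rule image_eqI[of _ _ "(a + b, c)"], simp, rule SigmaI, rule image_eqI[of _ _ "(a, b)"]) auto

lemma word_set_SucE:
  assumes "a \<in> word_set K (Suc n)"
  obtains b c d where "b \<in> word_set K n" "c \<in> word_set K n"
    "d \<in> insert 0 (e ` K n \<union> uminus ` e ` K n)" "a = b + c + d"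
proof -
  let ?W = "(\<lambda>p. fst p + snd p) ` (word_set K n \<times> word_set K n)"
  obtain p where p: "a = fst p + snd p" "p \<in> ?W \<times> insert 0 (e ` K n \<union> uminus ` e ` K n)"
    using assms unfolding word_set.simps(2) by (rule imageE)
  then have "fst p \<in> ?W" by (simp only: mem_Times_iff)
  then obtain q where "fst p = fst q + snd q" "q \<in> word_set K n \<times> word_set K n"
    by (rule imageE)
  with p show ?thesis
    by (intro that[of "fst q" "snd q" "snd p"]) (simp_all only: mem_Times_iff)
qed

lemma zero_in_word_set: "0 \<in> word_set K n"
proof (induction n)
  case (Suc n)
  then show ?case using word_set_SucI[OF Suc Suc insertI1] by (simp only: add_0)
qed (simp add: zero_fun_def)

lemma word_set_add: "a \<in> word_set K n \<Longrightarrow> b \<in> word_set K n \<Longrightarrow> a + b \<in> word_set K (Suc n)"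
  using word_set_SucI[OF _ _ insertI1, of a K n b] by (simp only: add_0_right)

lemma word_set_neg: "a \<in> word_set K n \<Longrightarrow> - a \<in> word_set K n"
proof (induction n arbitrary: a)
  case (Suc n)
  from Suc.prems obtain b c d where bcd: "b \<in> word_set K n" "c \<in> word_set K n"
    "d \<in> insert 0 (e ` K n \<union> uminus ` e ` K n)" "a = b + c + d"
    by (rule word_set_SucE)
  have "- d \<in> insert 0 (e ` K n \<union> uminus ` e ` K n)" using bcd(3) by auto
  with Suc.IH[OF bcd(1)] Suc.IH[OF bcd(2)] have "- b + - c + - d \<in> word_set K (Suc n)"
    by (intro word_set_SucI)
  moreover have "- b + - c + - d = - a" using bcd(4) by (simp add: algebra_simps)
  ultimately show ?case by metis
qed simp

lemma word_set_mono: "m \<le> n \<Longrightarrow> word_set K m \<subseteq> word_set K n"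
proof (rule lift_Suc_mono_le[of "word_set K"])
  show "word_set K n \<subseteq> word_set K (Suc n)" for n
    using word_set_add[OF _ zero_in_word_set] by fastforce
qed

lemma word_set_e: "x \<in> K n \<Longrightarrow> e x \<in> word_set K (Suc n)"
  using word_set_SucI[OF zero_in_word_set zero_in_word_set, of "e x" K n] by (simp add: add_0)

lemma compactin_word_set:
  assumes "\<And>n. compactin X (K n)"
  shows "compactin (free_top X) (word_set K n)"
proof (induction n)
  case 0
  then show ?case by (simp add: zero_in_carrier)
next
  case (Suc n)
  interpret abelian_group_topology "free_top X" by (rule abelian_group_topology_free_top)
  have "compactin (free_top X) (e ` K n)"
    using assms continuous_map_e by (rule image_compactin)
  then have "compactin (free_top X) (insert 0 (e ` K n \<union> uminus ` e ` K n))"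
    using compactin_Un[of "free_top X" "{0}" "e ` K n \<union> uminus ` e ` K n"] compactin_neg
    by (simp add: zero_in_carrier compactin_Un)
  with Suc show ?case by (simp only: word_set.simps(2)) (intro compactin_add)
qed

lemma Union_word_set:
  assumes "\<And>n. K n \<subseteq> topspace X" "(\<Union>n. K n) = topspace X"
  shows "(\<Union>n. word_set K n) = free_ab_carrier X"
proof (intro equalityI subsetI)
  fix a assume "a \<in> (\<Union>n. word_set K n)"
  then obtain n where "a \<in> word_set K n" by blast
  then show "a \<in> free_ab_carrier X"
  proof (induction n arbitrary: a)
    case (Suc n)
    from Suc.prems obtain b c d where bcd: "b \<in> word_set K n" "c \<in> word_set K n"
      "d \<in> insert 0 (e ` K n \<union> uminus ` e ` K n)" "a = b + c + d"
      by (rule word_set_SucE)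
    have "d \<in> free_ab_carrier X"
      using bcd(3) assms(1)[of n] by (auto simp: zero_in_carrier e_in_carrier neg_in_carrier)
    with Suc.IH[OF bcd(1)] Suc.IH[OF bcd(2)] show ?case
      unfolding bcd(4) by (intro add_in_carrier)
  qed (simp add: zero_in_carrier)
next
  have step: "a + c \<in> (\<Union>n. word_set K n)"
    if a: "a \<in> (\<Union>n. word_set K n)" and c: "c \<in> (\<Union>n. word_set K n)" for a c
  proof -
    obtain i j where "a \<in> word_set K i" "c \<in> word_set K j" using a c by blast
    then have "a \<in> word_set K (max i j)" "c \<in> word_set K (max i j)"
      using word_set_mono[of i "max i j" K] word_set_mono[of j "max i j" K] by auto
    then have "a + c \<in> word_set K (Suc (max i j))" by (rule word_set_add)
    then show ?thesis by blast
  qed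
  have gen: "e x \<in> (\<Union>n. word_set K n)" if "x \<in> topspace X" for x
  proof -
    obtain n where "x \<in> K n" using \<open>x \<in> topspace X\<close> unfolding assms(2)[symmetric] by blast
    from word_set_e[of x K n, OF this] show ?thesis by blast
  qed
  fix a assume "a \<in> free_ab_carrier X"
  then show "a \<in> (\<Union>n. word_set K n)"
  proof (induction rule: carrier_induct)
    case zero
    show ?case using zero_in_word_set[of K 0] by (rule UN_I[OF UNIV_I])
  next
    case (plus a x)
    show ?case by (rule step[OF plus.IH gen[OF plus.hyps(2)]])
  next
    case (minus a x)
    obtain n where "e x \<in> word_set K n" using gen[OF minus.hyps(2)] by blast
    from word_set_neg[OF this] have "- e x \<in> (\<Union>n. word_set K n)" by blast
    from step[OF minus.IH this] show ?case unfolding add_uminus_conv_diff .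
  qed
qed

lemma k_omega_submetrizable_imp:
  assumes "separable_space X" "tychonoff_space X" "submetrizable_space X" "k_omega_space X"
  shows "k_space (free_top X) \<and> free_ab_has_G_base X"
proof -
  obtain K where *: "(\<forall>n. compactin X (K n)) \<and> (\<forall>n. K n \<subseteq> K (Suc n)) \<and> (\<Union>n. K n) = topspace X \<and>
    (\<forall>S. S \<subseteq> topspace X \<longrightarrow>
      (closedin X S \<longleftrightarrow> (\<forall>n. closedin (subtopology X (K n)) (K n \<inter> S))))"
    using assms(4) unfolding k_omega_space_def by (elim exE)
  have K: "compactin X (K n)" "(\<Union>n. K n) = topspace X"
    "S \<subseteq> topspace X \<Longrightarrow> closedin X S \<longleftrightarrow> (\<forall>n. closedin (subtopology X (K n)) (K n \<inter> S))" for n S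
    using * by simp_all
  have KX: "K n \<subseteq> topspace X" for n using K(1) compactin_subset_topspace by blast
  interpret abelian_group_topology "free_top X" by (rule abelian_group_topology_free_top)
  interpret compact_filtration "free_top X" "word_set K"
  proof
    show "Hausdorff_space (free_top X)" by (rule Hausdorff_space_free_top[OF assms(2)])
    show "compactin (free_top X) (word_set K n)" for n by (rule compactin_word_set[OF K(1)])
    show "(\<Union>n. word_set K n) = topspace (free_top X)"
      using Union_word_set[OF KX K(2)] by simp
  qed (simp_all add: zero_in_word_set word_set_add word_set_neg)
  \<comment> \<open>\<open>e\<close> maps \<open>K n\<close> into \<open>word_set K (Suc n)\<close>,
    so preimages of limit-open sets have open traces on every \<open>K n\<close>, and these traces
    decide openness in \<open>X\<close>.\<close>
  have "continuous_map X limit_topology e"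
    unfolding continuous_map
  proof (intro conjI allI impI)
    show "e ` topspace X \<subseteq> topspace limit_topology" by (auto simp: e_in_carrier)
    fix U assume U: "openin limit_topology U"
    have "closedin (subtopology X (K n)) (K n \<inter> {x \<in> topspace X. e x \<notin> U})" for n
    proof -
      let ?S = "subtopology (free_top X) (word_set K (Suc n))"
      have "continuous_map (subtopology X (K n)) ?S e"
        using continuous_map_from_subtopology[OF continuous_map_e] word_set_e
        by (auto simp: continuous_map_in_subtopology)
      moreover have "openin ?S (word_set K (Suc n) \<inter> U)"
        using U openin_limit_topology by blast
      ultimately have "openin (subtopology X (K n))
          {x \<in> topspace (subtopology X (K n)). e x \<in> word_set K (Suc n) \<inter> U}"
        by (rule openin_continuous_map_preimage)
      from closedin_diff[OF closedin_topspace this]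
      show ?thesis
      proof (rule back_subst[of "closedin (subtopology X (K n))"])
        show "topspace (subtopology X (K n)) - {x \<in> topspace (subtopology X (K n)). e x \<in> word_set K (Suc n) \<inter> U}
          = K n \<inter> {x \<in> topspace X. e x \<notin> U}"
          using word_set_e[of _ K n] by (auto)
      qed
    qed
    then have "closedin X {x \<in> topspace X. e x \<notin> U}"
      using K(3)[of "{x \<in> topspace X. e x \<notin> U}"] by blast
    then have "openin X (topspace X - {x \<in> topspace X. e x \<notin> U})" by blast
    moreover have "topspace X - {x \<in> topspace X. e x \<notin> U} = {x \<in> topspace X. e x \<in> U}" by blast
    ultimately show "openin X {x \<in> topspace X. e x \<in> U}" by simp
  qed
  moreover have "free_ab_group_topology X limit_topology"
    by (simp add: free_ab_group_topology_iff abelian_group_topology_limit_topology)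
  \<comment> \<open>The limit topology is now admissible, hence contained in that of A(X); the
    reverse inclusion is \<open>openin_limit_topologyI\<close>.\<close>
  ultimately have "openin (free_top X) U" if "openin limit_topology U" for U
    using openin_free_topI that by blast
  then have L: "limit_topology = free_top X"
    unfolding topology_eq using openin_limit_topologyI by blast
  obtain h :: "nat \<Rightarrow> 'a \<Rightarrow> real" where h: "\<And>n. continuous_map X euclideanreal (h n)"
    "\<And>a. a \<in> free_ab_carrier X \<Longrightarrow> (\<And>n. ext (h n) a = 0) \<Longrightarrow> a = 0"
    using countable_separating_family[OF assms(1,3)] by blast
  \<comment> \<open>Each \<open>s j\<close> involves finitely many functionals and is therefore
    continuous. Since \<open>s j\<close> grows with \<open>j\<close> while the radius falls, the
    balls \<open>M j\<close> and \<open>N j\<close> decrease.\<close>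
  define s where "s j a = (\<Sum>i\<le>j. \<bar>ext (h i) a\<bar>)" for j a
  have s_cont: "continuous_map (free_top X) euclideanreal (s j)" for j
    unfolding s_def by (intro continuous_map_sum continuous_map_real_abs continuous_map_ext h) simp
  have s_mono: "s i a \<le> s j a" if "i \<le> j" for i j a
    unfolding s_def by (rule sum_mono2) (use that in auto)
  have ext_s: "\<bar>ext (h i) a\<bar> \<le> s i a" for i a
    unfolding s_def by (rule member_le_sum[of i]) auto
  define M where "M j = {a \<in> topspace (free_top X). s j a \<in> {..1 / (real j + 1)}}" for j
  define N where "N j = {a \<in> topspace (free_top X). s j a \<in> {..<1 / (real j + 1)}}" for j
  have le: "1 / (real j + 1) \<le> 1 / (real i + 1)" if "i \<le> j" for i j
    using that by (simp add: frac_le)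
  have "has_G_base_at limit_topology 0"
  proof (rule has_G_base_limit_topology[of M N])
    show "closedin (free_top X) (M j)" for j
      unfolding M_def by (rule closedin_continuous_map_preimage[OF s_cont]) simp
    show "openin (free_top X) (N j)" for j
      unfolding N_def by (rule openin_continuous_map_preimage[OF s_cont]) simp
    show "M j \<subseteq> M i" if "i \<le> j" for i j
      unfolding M_def using le[OF that] s_mono[OF that] by (auto intro: order_trans)
    show "N j \<subseteq> N i" if "i \<le> j" for i j
      unfolding N_def using le[OF that] s_mono[OF that] by (auto intro: order.strict_trans1 order.strict_trans2)
    show "0 \<in> N j" for j by (simp add: N_def s_def zero_in_carrier)
    show "N j \<subseteq> M j" for j by (auto simp: N_def M_def)
    show "(\<Inter>j. M j) = {0}"
    proof (intro equalityI subsetI)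
      fix a assume a: "a \<in> (\<Inter>j. M j)"
      have "ext (h i) a = 0" for i
      proof (rule ccontr)
        assume "ext (h i) a \<noteq> 0"
        then obtain n where n: "inverse (real (Suc n)) < \<bar>ext (h i) a\<bar>"
          using reals_Archimedean[of "\<bar>ext (h i) a\<bar>"] by auto
        \<comment> \<open>The index \<open>i\<close> brings the functional into the sum, the index
          \<open>n\<close> makes the radius smaller than its value at \<open>a\<close>.\<close>
        have "a \<in> M (max i n)" using a by blast
        then have "s (max i n) a \<le> 1 / (real n + 1)"
          using le[of n "max i n"] by (auto simp: M_def)
        with n ext_s[of i a] s_mono[of i "max i n" a] show False
          by (simp add: inverse_eq_divide add.commute)
      qed
      moreover have "a \<in> free_ab_carrier X" using a by (auto simp: M_def)
      ultimately show "a \<in> {0}" using h(2) by blast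
    qed (simp add: M_def s_def zero_in_carrier)
  qed
  then have "free_ab_has_G_base X"
    by (simp add: L free_ab_has_G_base_def zero_fun_def)
  moreover have "k_space (free_top X)" using k_space_limit_topology L by simp
  ultimately show ?thesis by blast
qed

section \<open>Sets whose sequences return to compact sets\<close>

text \<open>The compact set may depend on the sequence. The index set \<open>N\<close> allows the
  property to be applied again to a subsequence just obtained.\<close>

definition seq_rel_compact :: "'b topology \<Rightarrow> 'b set \<Rightarrow> bool" where
  "seq_rel_compact Y P \<longleftrightarrow>
     (\<forall>\<sigma> N. infinite (N :: nat set) \<and> \<sigma> ` N \<subseteq> P \<longrightarrow>
        (\<exists>C. compactin Y C \<and> infinite {n \<in> N. \<sigma> n \<in> C}))"

lemma seq_rel_compactD:
  fixes \<sigma> :: "nat \<Rightarrow> 'b"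
  assumes "seq_rel_compact Y P" "infinite N" "\<And>n. n \<in> N \<Longrightarrow> \<sigma> n \<in> P"
  obtains C where "compactin Y C" "infinite {n \<in> N. \<sigma> n \<in> C}"
proof -
  have "\<sigma> ` N \<subseteq> P" using assms(3) by blast
  with assms(1,2) show ?thesis using that unfolding seq_rel_compact_def by meson
qed

lemma compactin_imp_seq_rel_compact:
  fixes P :: "'b set"
  assumes "compactin Y C" "P \<subseteq> C" shows "seq_rel_compact Y P"
  unfolding seq_rel_compact_def
proof (intro allI impI)
  fix \<sigma> :: "nat \<Rightarrow> 'b" and N assume N: "infinite N \<and> \<sigma> ` N \<subseteq> P"
  then have "{n \<in> N. \<sigma> n \<in> C} = N" using assms(2) by blast
  with assms(1) N show "\<exists>C. compactin Y C \<and> infinite {n \<in> N. \<sigma> n \<in> C}" by auto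
qed

lemma seq_rel_compact_Un:
  fixes P :: "'b set"
  assumes "seq_rel_compact Y P" "seq_rel_compact Y Q" shows "seq_rel_compact Y (P \<union> Q)"
  unfolding seq_rel_compact_def
proof (intro allI impI)
  fix \<sigma> :: "nat \<Rightarrow> 'b" and N assume N: "infinite N \<and> \<sigma> ` N \<subseteq> P \<union> Q"
  have mono: "infinite {n \<in> N. \<sigma> n \<in> C}" if "infinite {n \<in> M. \<sigma> n \<in> C}" "M \<subseteq> N" for C M
  proof -
    have "{n \<in> M. \<sigma> n \<in> C} \<subseteq> {n \<in> N. \<sigma> n \<in> C}" using \<open>M \<subseteq> N\<close> by blast
    then show ?thesis using that(1) finite_subset by blast
  qed
  have "N = {n \<in> N. \<sigma> n \<in> P} \<union> {n \<in> N. \<sigma> n \<in> Q}" using N by auto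
  then have "infinite {n \<in> N. \<sigma> n \<in> P} \<or> infinite {n \<in> N. \<sigma> n \<in> Q}"
    using N by (metis finite_Un)
  then show "\<exists>C. compactin Y C \<and> infinite {n \<in> N. \<sigma> n \<in> C}"
  proof
    assume "infinite {n \<in> N. \<sigma> n \<in> P}"
    then obtain C where "compactin Y C" "infinite {n \<in> {n \<in> N. \<sigma> n \<in> P}. \<sigma> n \<in> C}"
      by (rule seq_rel_compactD[OF assms(1), of _ \<sigma>]) auto
    then show ?thesis using mono[of "{n \<in> N. \<sigma> n \<in> P}" C] by blast
  next
    assume "infinite {n \<in> N. \<sigma> n \<in> Q}"
    then obtain C where "compactin Y C" "infinite {n \<in> {n \<in> N. \<sigma> n \<in> Q}. \<sigma> n \<in> C}"
      by (rule seq_rel_compactD[OF assms(2), of _ \<sigma>]) auto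
    then show ?thesis using mono[of "{n \<in> N. \<sigma> n \<in> Q}" C] by blast
  qed
qed

text \<open>The tolerance \<open>1/4\<close> suits the threshold in \<open>pos\<close>: where a
  function is \<open>1\<close> its approximant is at least \<open>3/4\<close>, where it is
  \<open>0\<close> at most \<open>1/4\<close>. Hence the countably many sets \<open>pos g\<close>
  trace a base on the closure of \<open>P\<close>.\<close>

locale approximated_set =
  fixes X :: "'a topology" and P :: "'a set" and F :: "('a \<Rightarrow> real) set"
  assumes tychonoff: "tychonoff_space X"
    and subset: "P \<subseteq> topspace X"
    and rel_compact: "seq_rel_compact X P"
    and countable: "countable F"
    and cont: "g \<in> F \<Longrightarrow> continuous_map X euclideanreal g"
    and approx: "continuous_map X euclideanreal f \<Longrightarrow> (\<And>x. x \<in> topspace X \<Longrightarrow> f x \<in> {0..1}) \<Longrightarrow>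
      \<exists>g\<in>F. \<forall>x\<in>P. \<bar>f x - g x\<bar> \<le> 1/4"
begin

abbreviation "K \<equiv> X closure_of P"
abbreviation "pos g \<equiv> {x \<in> topspace X. g x \<in> {(1/2::real)<..}}"

lemma approx_closure:
  assumes "continuous_map X euclideanreal f" "\<And>x. x \<in> topspace X \<Longrightarrow> f x \<in> {0..1}"
  obtains g where "g \<in> F" "\<And>x. x \<in> K \<Longrightarrow> \<bar>f x - g x\<bar> \<le> 1/4"
proof -
  obtain g where g: "g \<in> F" "\<forall>x\<in>P. \<bar>f x - g x\<bar> \<le> 1/4" using approx[OF assms] by blast
  have "continuous_map X euclideanreal (\<lambda>x. \<bar>f x - g x\<bar>)"
    by (intro continuous_map_real_abs continuous_map_diff assms(1) cont g(1))
  then have "closedin X {x \<in> topspace X. \<bar>f x - g x\<bar> \<in> {..1/4}}"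
    by (rule closedin_continuous_map_preimage) simp
  moreover have "P \<subseteq> {x \<in> topspace X. \<bar>f x - g x\<bar> \<in> {..1/4}}" using g(2) subset by auto
  ultimately have "K \<subseteq> {x \<in> topspace X. \<bar>f x - g x\<bar> \<in> {..1/4}}" by (intro closure_of_minimal)
  then show ?thesis using that[OF g(1)] by auto
qed

lemma openin_pos: "g \<in> F \<Longrightarrow> openin X (pos g)"
  by (rule openin_continuous_map_preimage[OF cont]) auto

lemma pos_base:
  assumes "openin X U" "z \<in> K" "z \<in> U"
  obtains g where "g \<in> F" "z \<in> pos g" "K \<inter> pos g \<subseteq> U"
proof -
  have z: "z \<in> topspace X" using assms openin_subset by blast
  obtain f :: "'a \<Rightarrow> real" where f: "continuous_map X euclideanreal f"
    "\<And>y. y \<in> topspace X \<Longrightarrow> f y \<in> {0..1}" "f z = 1" "\<And>y. y \<in> topspace X - U \<Longrightarrow> f y = 0"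
    using tychonoff_separate[OF tychonoff, of "topspace X - U" z] assms z by blast
  obtain g where g: "g \<in> F" "\<And>x. x \<in> K \<Longrightarrow> \<bar>f x - g x\<bar> \<le> 1/4"
    using approx_closure[OF f(1,2)] by blast
  have "g z \<ge> 3/4" using g(2)[OF assms(2)] f(3) by linarith
  then have "z \<in> pos g" using z by auto
  moreover have "K \<inter> pos g \<subseteq> U"
  proof
    fix x assume x: "x \<in> K \<inter> pos g"
    show "x \<in> U"
    proof (rule ccontr)
      assume "x \<notin> U"
      then have "f x = 0" using f(4) x by blast
      moreover have "g x > 1/2" using x by simp
      ultimately show False using g(2)[of x] x by (simp add: abs_if)
    qed
  qed
  ultimately show ?thesis using that g(1) by blast
qed

lemma separating:
  assumes "x \<in> K" "y \<in> K" "x \<noteq> y"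
  obtains g where "g \<in> F" "g x \<noteq> g y"
proof -
  have xy: "x \<in> topspace X" "y \<in> topspace X"
    using assms closure_of_subset_topspace[of X P] by auto
  have "closedin X {y}" using tychonoff_closedin_finite[OF tychonoff] xy by simp
  then have "openin X (topspace X - {y})" by blast
  then obtain g where "g \<in> F" "x \<in> pos g" "K \<inter> pos g \<subseteq> topspace X - {y}"
    using pos_base[of "topspace X - {y}" x] assms xy by blast
  moreover from this have "y \<notin> pos g" using assms(2) by blast
  ultimately show ?thesis using that[of g] xy by auto
qed

lemma second_countable_closure: "second_countable (subtopology X K)"
  unfolding second_countable_def
proof (intro exI[of _ "(\<lambda>g. K \<inter> pos g) ` F"] conjI ballI allI impI)
  show "countable ((\<lambda>g. K \<inter> pos g) ` F)" using countable by simp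
  show "openin (subtopology X K) V" if V: "V \<in> (\<lambda>g. K \<inter> pos g) ` F" for V
  proof -
    obtain g where "g \<in> F" "V = K \<inter> pos g" using V by blast
    then show ?thesis using openin_pos openin_subtopology_Int2 by metis
  qed
  fix U z assume "openin (subtopology X K) U \<and> z \<in> U"
  then obtain W where W: "openin X W" "U = W \<inter> K" "z \<in> W" "z \<in> K"
    by (auto simp: openin_subtopology)
  obtain g where "g \<in> F" "z \<in> pos g" "K \<inter> pos g \<subseteq> W" by (rule pos_base[OF W(1,4,3)])
  with W show "\<exists>V\<in>(\<lambda>g. K \<inter> pos g) ` F. z \<in> V \<and> V \<subseteq> U"
    by (intro bexI[of _ "K \<inter> pos g"] conjI imageI) auto
qed

text \<open>Countably many sets \<open>pos g\<close> cover the closure, each with a trace whose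
  closure lies in a member of the cover. If no finite number of these closures sufficed, points of
  \<open>P\<close> outside ever longer initial pieces would return infinitely often to a compact
  set, where finitely many \<open>pos g\<close> suffice.\<close>

lemma compactin_closure: "compactin X K"
  unfolding compactin_def
proof (intro conjI allI impI)
  show "K \<subseteq> topspace X" by (rule closure_of_subset_topspace)
  fix \<U> assume \<U>: "(\<forall>U\<in>\<U>. openin X U) \<and> K \<subseteq> \<Union>\<U>"
  define F' where "F' = {g \<in> F. \<exists>U\<in>\<U>. X closure_of (K \<inter> pos g) \<subseteq> U}"
  have cover: "\<exists>g\<in>F'. z \<in> pos g" if z: "z \<in> K" for z
  proof -
    obtain U where U: "U \<in> \<U>" "openin X U" "z \<in> U" using \<U> z by blast
    have "regular_space X"
      using tychonoff completely_regular_imp_regular_space unfolding tychonoff_space_def by blast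
    then have "neighbourhood_base_of (closedin X) X" by (simp add: neighbourhood_base_of_closedin)
    then obtain W V where W: "openin X W" "closedin X V" "z \<in> W" "W \<subseteq> V" "V \<subseteq> U"
      using U(2,3) unfolding neighbourhood_base_of by meson
    obtain g where g: "g \<in> F" "z \<in> pos g" "K \<inter> pos g \<subseteq> W"
      by (rule pos_base[OF W(1) z W(3)])
    have "X closure_of (K \<inter> pos g) \<subseteq> V" by (rule closure_of_minimal) (use g W in auto)
    then have "X closure_of (K \<inter> pos g) \<subseteq> U" using W(5) by blast
    with g U(1) show ?thesis unfolding F'_def by blast
  qed
  show "\<exists>\<F>. finite \<F> \<and> \<F> \<subseteq> \<U> \<and> K \<subseteq> \<Union>\<F>"
  proof (cases "K = {}")
    case True
    then show ?thesis by blast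
  next
    case False
    then have F': "F' \<noteq> {}" "countable F'"
      using cover countable unfolding F'_def by (blast, auto)
    define g where "g = from_nat_into F'"
    have rg: "range g = F'" unfolding g_def using F' by (simp add: range_from_nat_into)
    let ?L = "\<lambda>i. X closure_of (K \<inter> pos (g i))"
    have "\<exists>n. K \<subseteq> (\<Union>i<n. ?L i)"
    proof (rule ccontr)
      assume no: "\<nexists>n. K \<subseteq> (\<Union>i<n. ?L i)"
      \<comment> \<open>Since the \<open>?L i\<close> are closed, what they leave uncovered is an
        open set meeting the closure of \<open>P\<close>, hence \<open>P\<close> itself, where
        \<open>rel_compact\<close> applies.\<close>
      have "\<exists>p. p \<in> P \<and> p \<notin> (\<Union>i<n. ?L i)" for n
      proof -
        obtain z where z: "z \<in> K" "z \<notin> (\<Union>i<n. ?L i)" using no by blast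
        have "closedin X (\<Union>i<n. ?L i)" by (intro closedin_Union) auto
        then have "openin X (topspace X - (\<Union>i<n. ?L i))" by blast
        moreover have "z \<in> topspace X" using z(1) closure_of_subset_topspace[of X P] by blast
        ultimately show ?thesis using z unfolding in_closure_of by blast
      qed
      then have "\<exists>p. \<forall>n. p n \<in> P \<and> p n \<notin> (\<Union>i<n. ?L i)" by (intro choice allI)
      then obtain p where p: "\<And>n. p n \<in> P" "\<And>n. p n \<notin> (\<Union>i<n. ?L i)" by blast
      obtain C where C: "compactin X C" "infinite {n \<in> UNIV. p n \<in> C}"
        by (rule seq_rel_compactD[OF rel_compact, of UNIV p]) (use p in auto)
      have CK: "compactin X (K \<inter> C)"
        using closed_Int_compactin[OF closedin_closure_of C(1)] .
      have "K \<inter> C \<subseteq> (\<Union>i. pos (g i))" using cover rg by blast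
      moreover have "openin X (pos (g i))" for i using openin_pos rg F'_def by blast
      ultimately obtain \<F> where \<F>: "finite \<F>" "\<F> \<subseteq> range (\<lambda>i. pos (g i))" "K \<inter> C \<subseteq> \<Union>\<F>"
        using compactinD[OF CK, of "range (\<lambda>i. pos (g i))"] by blast
      obtain J where J: "finite J" "\<F> = (\<lambda>i. pos (g i)) ` J"
        using finite_subset_image[OF \<F>(1,2)] by blast
      obtain m where m: "\<And>i. i \<in> J \<Longrightarrow> i < m"
        using finite_nat_set_iff_bounded[THEN iffD1, OF J(1)] by auto
      obtain n where n: "n \<ge> m" "p n \<in> C"
        using C(2) unfolding infinite_nat_iff_unbounded_le by blast
      have pK: "p n \<in> K" using p(1) closure_of_subset[OF subset] by blast
      then obtain i where i: "i \<in> J" "p n \<in> pos (g i)" using n(2) \<F>(3) J(2) by blast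
      have "K \<inter> pos (g i) \<subseteq> ?L i" by (rule closure_of_subset) auto
      then have "p n \<in> ?L i" using pK i(2) by blast
      moreover have "i < n" using m[OF i(1)] n(1) by simp
      ultimately show False using p(2)[of n] by blast
    qed
    then obtain n where n: "K \<subseteq> (\<Union>i<n. ?L i)" by blast
    have "\<forall>i. \<exists>U. U \<in> \<U> \<and> ?L i \<subseteq> U" using rg unfolding F'_def by blast
    then have "\<exists>W. \<forall>i. W i \<in> \<U> \<and> ?L i \<subseteq> W i" by (intro choice)
    then obtain W where W: "\<And>i. W i \<in> \<U>" "\<And>i. ?L i \<subseteq> W i" by blast
    have "(\<Union>i<n. ?L i) \<subseteq> (\<Union>i<n. W i)" by (rule UN_mono[OF subset_refl W(2)])
    with n have "K \<subseteq> \<Union> (W ` {..<n})" by (rule subset_trans)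
    moreover have "W ` {..<n} \<subseteq> \<U>" using W(1) by blast
    ultimately show ?thesis by (intro exI[of _ "W ` {..<n}"] conjI) auto
  qed
qed

end

section \<open>Families of functions indexed by sequences of natural numbers\<close>

text \<open>At coordinate \<open>i\<close> only the indices \<open>b k\<close> with
  \<open>k \<le> i\<close> can differ from \<open>\<alpha> i\<close>, so a finite sum bounds them
  all.\<close>

lemma dominating_sequence:
  fixes b :: "nat \<Rightarrow> nat \<Rightarrow> nat"
  assumes "\<And>k i. i < k \<Longrightarrow> b k i = \<alpha> i"
  obtains \<beta> where "\<And>k i. b k i \<le> \<beta> i"
proof (rule that[of "\<lambda>i. \<alpha> i + (\<Sum>k\<le>i. b k i)"])
  fix k i
  show "b k i \<le> \<alpha> i + (\<Sum>k\<le>i. b k i)"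
  proof (cases "i < k")
    case False
    then have "b k i \<le> (\<Sum>k\<le>i. b k i)" by (intro member_le_sum) auto
    then show ?thesis by simp
  qed (use assms in simp)
qed

text \<open>Dependent choice in which the state carries the finite set of all earlier terms besides
  the newest one.\<close>

lemma avoiding_sequence:
  assumes "\<And>n Z. finite Z \<Longrightarrow> Z \<subseteq> S \<Longrightarrow> \<exists>x\<in>S. Q n x \<and> (\<forall>z\<in>Z. R z x)"
  obtains f :: "nat \<Rightarrow> 'b" where "\<And>n. f n \<in> S" "\<And>n. Q n (f n)" "\<And>m n. m < n \<Longrightarrow> R (f m) (f n)"
proof -
  have "\<exists>p. \<forall>n. (finite (snd (p n)) \<and> snd (p n) \<subseteq> S) \<and>
    (fst (p (Suc n)) \<in> S \<and> Q n (fst (p (Suc n))) \<and> (\<forall>z\<in>snd (p n). R z (fst (p (Suc n)))) \<and>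
     snd (p (Suc n)) = insert (fst (p (Suc n))) (snd (p n)))"
  proof (rule dependent_nat_choice)
    \<comment> \<open>The first component of the initial state is a dummy; the sequence is read off
      from index \<open>Suc n\<close> on.\<close>
    show "\<exists>p. finite (snd p) \<and> snd p \<subseteq> S" by (rule exI[of _ "(undefined, {})"]) simp
    fix p :: "'b \<times> 'b set" and n assume p: "finite (snd p) \<and> snd p \<subseteq> S"
    then obtain x where "x \<in> S" "Q n x" "\<forall>z\<in>snd p. R z x" using assms[of "snd p" n] by blast
    with p show "\<exists>q. (finite (snd q) \<and> snd q \<subseteq> S) \<and> (fst q \<in> S \<and> Q n (fst q) \<and>
        (\<forall>z\<in>snd p. R z (fst q)) \<and> snd q = insert (fst q) (snd p))"
      by (intro exI[of _ "(x, insert x (snd p))"]) auto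
  qed
  then obtain p where p: "\<And>n. fst (p (Suc n)) \<in> S" "\<And>n. Q n (fst (p (Suc n)))"
    "\<And>n z. z \<in> snd (p n) \<Longrightarrow> R z (fst (p (Suc n)))"
    "\<And>n. snd (p (Suc n)) = insert (fst (p (Suc n))) (snd (p n))" by metis
  have "snd (p m) \<subseteq> snd (p n)" if "m \<le> n" for m n
    using that by (rule lift_Suc_mono_le[of "\<lambda>n. snd (p n)", rotated]) (use p(4) in blast)
  then have "fst (p (Suc m)) \<in> snd (p n)" if "m < n" for m n
    using that p(4)[of m] by (metis Suc_leI insertI1 subsetD)
  then show ?thesis using that[of "\<lambda>n. fst (p (Suc n))"] p(1-3) by blast
qed

text \<open>The Cascales-Orihuela argument: the functions that are \<open>\<epsilon>\<close>-uniform for some \<open>E b\<close> with \<open>b\<close>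
  extending a finite word form one of countably many classes. Were no class along \<open>\<alpha>\<close> to have a finite
  \<open>3\<epsilon>\<close>-net, a \<open>3\<epsilon>\<close>-separated sequence with members in these classes would be \<open>\<epsilon>\<close>-uniform for a single
  \<open>E \<beta>\<close>, against precompactness.\<close>

lemma countable_approximation:
  fixes E :: "(nat \<Rightarrow> nat) \<Rightarrow> ('a \<times> 'a) set" and \<F> :: "('a \<Rightarrow> real) set"
  assumes \<epsilon>: "\<epsilon> > 0"
    and anti: "\<And>\<alpha> \<beta>. (\<And>i. \<alpha> i \<le> \<beta> i) \<Longrightarrow> E \<beta> \<subseteq> E \<alpha>"
    and precompact: "\<And>\<alpha>. \<exists>Z. finite Z \<and> Z \<subseteq> P \<and> (\<forall>x\<in>P. \<exists>z\<in>Z. (x, z) \<in> E \<alpha>)"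
    and range: "\<And>f x. f \<in> \<F> \<Longrightarrow> x \<in> P \<Longrightarrow> f x \<in> {0..1}"
    and unif: "\<And>f. f \<in> \<F> \<Longrightarrow> \<exists>\<alpha>. \<forall>x y. (x, y) \<in> E \<alpha> \<longrightarrow> \<bar>f x - f y\<bar> \<le> \<epsilon>"
  shows "\<exists>F. countable F \<and> F \<subseteq> \<F> \<and> (\<forall>f\<in>\<F>. \<exists>g\<in>F. \<forall>x\<in>P. \<bar>f x - g x\<bar> \<le> 3 * \<epsilon>)"
proof -
  define A where "A \<alpha> = {f \<in> \<F>. \<forall>x y. (x, y) \<in> E \<alpha> \<longrightarrow> \<bar>f x - f y\<bar> \<le> \<epsilon>}" for \<alpha>
  define B where "B s = \<Union> (A ` {b. \<forall>i<length s. b i = s ! i})" for s :: "nat list"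
  define net where "net s Z \<longleftrightarrow> finite Z \<and> Z \<subseteq> \<F> \<and> (\<forall>f\<in>B s. \<exists>g\<in>Z. \<forall>x\<in>P. \<bar>f x - g x\<bar> \<le> 3 * \<epsilon>)"
    for s Z
  have net: "\<exists>k Z. net (map \<alpha> [0..<k]) Z" for \<alpha>
  proof (rule ccontr)
    assume no: "\<nexists>k Z. net (map \<alpha> [0..<k]) Z"
    have "\<exists>f\<in>\<F>. f \<in> B (map \<alpha> [0..<n]) \<and> (\<forall>g\<in>Z. \<not> (\<forall>x\<in>P. \<bar>f x - g x\<bar> \<le> 3 * \<epsilon>))"
      if Z: "finite Z" "Z \<subseteq> \<F>" for n Z
    proof -
      have "\<not> net (map \<alpha> [0..<n]) Z" using no by blast
      then obtain f where "f \<in> B (map \<alpha> [0..<n])" "\<not> (\<exists>g\<in>Z. \<forall>x\<in>P. \<bar>f x - g x\<bar> \<le> 3 * \<epsilon>)"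
        using Z unfolding net_def by blast
      moreover from this have "f \<in> \<F>" unfolding B_def A_def by blast
      ultimately show ?thesis by blast
    qed
    from avoiding_sequence[of \<F> "\<lambda>n f. f \<in> B (map \<alpha> [0..<n])"
        "\<lambda>g f. \<not> (\<forall>x\<in>P. \<bar>f x - g x\<bar> \<le> 3 * \<epsilon>)", OF this]
    obtain f where f: "\<And>n. f n \<in> \<F>" "\<And>n. f n \<in> B (map \<alpha> [0..<n])"
      "\<And>m n. m < n \<Longrightarrow> \<not> (\<forall>x\<in>P. \<bar>f n x - f m x\<bar> \<le> 3 * \<epsilon>)"
      by (metis (no_types, lifting))
    have "\<exists>b. f n \<in> A b \<and> (\<forall>i<n. b i = \<alpha> i)" for n
      using f(2)[of n] unfolding B_def by auto
    then obtain b where b: "\<And>n. f n \<in> A (b n)" "\<And>n i. i < n \<Longrightarrow> b n i = \<alpha> i" by metis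
    obtain \<beta> where \<beta>: "\<And>n i. b n i \<le> \<beta> i" using dominating_sequence[of b \<alpha>] b(2) by blast
    have small: "\<bar>f n x - f n y\<bar> \<le> \<epsilon>" if "(x, y) \<in> E \<beta>" for n x y
      using b(1)[of n] anti[of "b n" \<beta>] \<beta> that unfolding A_def by blast
    obtain Z where Z: "finite Z" "Z \<subseteq> P" "\<And>x. x \<in> P \<Longrightarrow> \<exists>z\<in>Z. (x, z) \<in> E \<beta>"
      using precompact[of \<beta>] by blast
    \<comment> \<open>Rounding the values on \<open>Z\<close> to multiples of
      \<open>\<epsilon>\<close> leaves finitely many patterns, so two functions share one. They
      differ by at most \<open>\<epsilon>\<close> on \<open>Z\<close>, and moving from
      \<open>x\<close> to a close \<open>z\<close> costs another \<open>\<epsilon>\<close> for each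
      of them: hence \<open>3 * \<epsilon>\<close>.\<close>
    define \<Phi> where "\<Phi> n = restrict (\<lambda>z. \<lfloor>f n z / \<epsilon>\<rfloor>) Z" for n
    have "range \<Phi> \<subseteq> PiE Z (\<lambda>_. {0..\<lfloor>1 / \<epsilon>\<rfloor>})"
    proof clarify
      fix n
      show "\<Phi> n \<in> PiE Z (\<lambda>_. {0..\<lfloor>1 / \<epsilon>\<rfloor>})"
      proof
        fix z assume "z \<in> Z"
        then have "f n z \<in> {0..1}" using range[OF f(1)] Z(2) by blast
        then have "0 \<le> f n z / \<epsilon>" "f n z / \<epsilon> \<le> 1 / \<epsilon>" using \<epsilon> by (auto simp: divide_right_mono)
        then show "\<Phi> n z \<in> {0..\<lfloor>1 / \<epsilon>\<rfloor>}" using \<open>z \<in> Z\<close> by (simp add: \<Phi>_def floor_mono)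
      qed (simp add: \<Phi>_def)
    qed
    then have "finite (range \<Phi>)" using finite_PiE[OF Z(1)] by (meson finite_atLeastAtMost_int finite_subset)
    then have "\<not> inj \<Phi>" using finite_imageD infinite_UNIV_nat by blast
    then obtain m n where mn: "m < n" "\<Phi> m = \<Phi> n" unfolding inj_def by (metis linorder_neqE_nat)
    have "\<bar>f n x - f m x\<bar> \<le> 3 * \<epsilon>" if "x \<in> P" for x
    proof -
      obtain z where z: "z \<in> Z" "(x, z) \<in> E \<beta>" using Z(3)[OF \<open>x \<in> P\<close>] by blast
      have "\<lfloor>f m z / \<epsilon>\<rfloor> = \<lfloor>f n z / \<epsilon>\<rfloor>" using fun_cong[OF mn(2), of z] z(1) by (simp add: \<Phi>_def)
      then have "\<bar>f n z / \<epsilon> - f m z / \<epsilon>\<bar> \<le> 1" by linarith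
      then have "\<bar>f n z - f m z\<bar> / \<epsilon> \<le> 1" using \<epsilon> by (simp flip: diff_divide_distrib)
      then have "\<bar>f n z - f m z\<bar> \<le> \<epsilon>" using \<epsilon> by simp
      with small[OF z(2), of n] small[OF z(2), of m] show ?thesis by linarith
    qed
    with f(3)[OF mn(1)] show False by blast
  qed
  \<comment> \<open>There are countably many words. One finite net is kept for each word in
    \<open>S\<close>, and every function of the family lies in a class \<open>B s\<close> with
    \<open>s\<close> in \<open>S\<close>.\<close>
  define S where "S = {s. \<exists>Z. net s Z}"
  define N where "N s = (SOME Z. net s Z)" for s
  have N: "net s (N s)" if "s \<in> S" for s
    using that unfolding S_def N_def by (auto intro: someI_ex)
  show ?thesis
  proof (intro exI[of _ "\<Union>s\<in>S. N s"] conjI ballI)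
    show "countable (\<Union>s\<in>S. N s)"
      using N unfolding net_def by (intro countable_UN) (auto intro: countable_finite)
    show "(\<Union>s\<in>S. N s) \<subseteq> \<F>" using N unfolding net_def by blast
    fix f assume f: "f \<in> \<F>"
    then obtain \<alpha> where "f \<in> A \<alpha>" using unif unfolding A_def by blast
    obtain k Z where k: "net (map \<alpha> [0..<k]) Z" using net by blast
    have "f \<in> B (map \<alpha> [0..<k])" unfolding B_def using \<open>f \<in> A \<alpha>\<close> by auto
    moreover have "map \<alpha> [0..<k] \<in> S" using k unfolding S_def by blast
    ultimately show "\<exists>g\<in>\<Union>s\<in>S. N s. \<forall>x\<in>P. \<bar>f x - g x\<bar> \<le> 3 * \<epsilon>"
      using N[of "map \<alpha> [0..<k]"] unfolding net_def by blast
  qed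
qed

text \<open>Together the functions inject \<open>X\<close> continuously into a countable power of
  the real line, whose metric is pulled back.\<close>

lemma submetrizable_space_countable_family:
  fixes F :: "('a \<Rightarrow> real) set"
  assumes F: "countable F" "\<And>g. g \<in> F \<Longrightarrow> continuous_map X euclideanreal g"
    and sep: "\<And>x y. x \<in> topspace X \<Longrightarrow> y \<in> topspace X \<Longrightarrow> x \<noteq> y \<Longrightarrow> \<exists>g\<in>F. g x \<noteq> g y"
  shows "submetrizable_space X"
proof -
  define h where "h = from_nat_into (insert (\<lambda>_. 0) F)"
  have rh: "range h = insert (\<lambda>_. 0) F"
    unfolding h_def using F(1) by (simp add: range_from_nat_into)
  have hc: "continuous_map X euclideanreal (h n)" for n
  proof -
    have "h n \<in> insert (\<lambda>_. 0) F" using rh by blast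
    then show ?thesis using F(2) by auto
  qed
  define \<Phi> where "\<Phi> x = (\<lambda>n. h n x)" for x
  have \<Phi>c: "continuous_map X euclidean \<Phi>"
    unfolding euclidean_product_topology[symmetric] continuous_map_componentwise_UNIV \<Phi>_def using hc by simp
  have inj: "\<Phi> x \<noteq> \<Phi> y" if xy: "x \<in> topspace X" "y \<in> topspace X" "x \<noteq> y" for x y
  proof -
    obtain g where "g \<in> F" "g x \<noteq> g y" using sep[OF xy] by blast
    moreover obtain n where "g = h n" using rh \<open>g \<in> F\<close> by blast
    ultimately show ?thesis unfolding \<Phi>_def by metis
  qed
  interpret D: Metric_space "topspace X" "\<lambda>x y. dist (\<Phi> x) (\<Phi> y)"
    by unfold_locales (use inj in \<open>auto simp: dist_commute dist_triangle\<close>)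
  have ball: "openin X (D.mball x r)" if "x \<in> topspace X" for x r
  proof -
    have "openin X {y \<in> topspace X. \<Phi> y \<in> ball (\<Phi> x) r}"
      by (rule openin_continuous_map_preimage[OF \<Phi>c]) simp
    moreover have "D.mball x r = {y \<in> topspace X. \<Phi> y \<in> ball (\<Phi> x) r}"
      using that by (auto simp: D.mball_def)
    ultimately show ?thesis by simp
  qed
  have "openin X U" if U: "openin D.mtopology U" for U
  proof (subst openin_subopen, intro ballI)
    fix x assume "x \<in> U"
    then obtain r where "r > 0" "D.mball x r \<subseteq> U" "x \<in> topspace X"
      using U unfolding D.openin_mtopology by blast
    then show "\<exists>T. openin X T \<and> x \<in> T \<and> T \<subseteq> U" using ball[of x r] by (intro exI[of _ "D.mball x r"]) auto
  qed
  then show ?thesis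
    unfolding submetrizable_space_def
    by (intro exI[of _ D.mtopology] conjI D.metrizable_space_mtopology) auto
qed

section \<open>The embedding of X into A(X)\<close>

text \<open>If \<open>ext f a\<close> lies outside a closed set containing all values of
  \<open>f\<close>, then \<open>a\<close> has a neighbourhood missing the image. The constant
  \<open>1\<close> tests the sum of the coefficients, functions into \<open>{0..1}\<close> test
  single coefficients, and an element passing both tests is some \<open>e x\<close>.\<close>

lemma closedin_range_e:
  assumes "tychonoff_space X"
  shows "closedin (free_top X) (e ` topspace X)"
proof -
  let ?R = "topspace (free_top X) - e ` topspace X"
  have sep: "\<exists>V. openin (free_top X) V \<and> a \<in> V \<and> V \<subseteq> ?R"
    if f: "continuous_map X euclideanreal f" "closed S" "\<And>x. x \<in> topspace X \<Longrightarrow> f x \<in> S"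
      and a: "a \<in> free_ab_carrier X" "ext f a \<notin> S" for f S a
  proof -
    let ?V = "{b \<in> topspace (free_top X). ext f b \<in> - S}"
    have "openin (free_top X) ?V"
      by (rule openin_continuous_map_preimage[OF continuous_map_ext[OF f(1)]]) (use f(2) in auto)
    moreover have "a \<in> ?V" using a by simp
    moreover have "?V \<subseteq> ?R" using f(3) by auto
    ultimately show ?thesis by blast
  qed
  have "openin (free_top X) ?R"
  proof (subst openin_subopen, intro ballI)
    fix a assume a: "a \<in> ?R"
    then have ac: "a \<in> free_ab_carrier X" by simp
    consider "ext (\<lambda>_. 1) a \<noteq> 1" | x where "a x \<notin> {0, 1}"
      | "ext (\<lambda>_. 1) a = 1" "\<And>x. a x \<in> {0, 1}" by blast
    then show "\<exists>V. openin (free_top X) V \<and> a \<in> V \<and> V \<subseteq> ?R"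
    proof cases
      case 1
      then show ?thesis using sep[of "\<lambda>_. 1" "{1}" a] ac by simp
    next
      case (2 x)
      then have "x \<in> topspace X" using ac by (auto simp: free_ab_carrier_def)
      then obtain f :: "'a \<Rightarrow> real" where f: "continuous_map X euclideanreal f"
        "\<And>y. y \<in> topspace X \<Longrightarrow> f y \<in> {0..1}" "ext f a = of_int (a x)"
        using tychonoff_separate_coefficient[OF assms ac] by metis
      have "ext f a \<notin> {0..1}" using 2 f(3) by auto
      then show ?thesis using sep[OF f(1) _ f(2) ac] by simp
    next
      case 3
      have fin: "finite {x. a x \<noteq> 0}" using ac by (simp add: free_ab_carrier_def)
      have "ext (\<lambda>_. 1) a = (\<Sum>x | a x \<noteq> 0. 1)"
        unfolding ext_def by (rule sum.cong) (use 3(2) in auto)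
      then have "card {x. a x \<noteq> 0} = 1" using 3(1) by simp
      then obtain x where x: "{x. a x \<noteq> 0} = {x}" by (rule card_1_singletonE)
      have "a y = e x y" for y
      proof (cases "y = x")
        case True
        then have "a y \<noteq> 0" using x by blast
        then show ?thesis using 3(2)[of y] True by auto
      next
        case False
        then have "a y = 0" using x by blast
        then show ?thesis using False by simp
      qed
      then have "a = e x" by blast
      moreover have "x \<in> topspace X" using ac x by (auto simp: free_ab_carrier_def)
      ultimately show ?thesis using a by blast
    qed
  qed
  moreover have "e ` topspace X \<subseteq> topspace (free_top X)" by (auto simp: e_in_carrier)
  ultimately show ?thesis by (simp add: closedin_def)
qed

lemma embedding_map_e:
  assumes "tychonoff_space X"
  shows "embedding_map X (free_top X) e"
  unfolding embedding_map_def
proof (rule bijective_open_imp_homeomorphic_map)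
  have sub: "e ` topspace X \<subseteq> topspace (free_top X)" by (auto simp: e_in_carrier)
  show "continuous_map X (subtopology (free_top X) (e ` topspace X)) e"
    using continuous_map_e by (auto simp: continuous_map_in_subtopology)
  show "e ` topspace X = topspace (subtopology (free_top X) (e ` topspace X))" using sub by auto
  show "inj_on e (topspace X)" by (rule inj_on_subset[OF inj_e subset_UNIV])
  show "open_map X (subtopology (free_top X) (e ` topspace X)) e"
    unfolding open_map_def
  proof (intro allI impI, subst openin_subopen, intro ballI)
    fix U a assume U: "openin X U" and "a \<in> e ` U"
    then obtain x where x: "a = e x" "x \<in> U" by blast
    have xX: "x \<in> topspace X" using x(2) openin_subset[OF U] by blast
    obtain f :: "'a \<Rightarrow> real" where f: "continuous_map X euclideanreal f"
      "\<And>y. y \<in> topspace X \<Longrightarrow> f y \<in> {0..1}" "f x = 1" "\<And>y. y \<in> topspace X - U \<Longrightarrow> f y = 0"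
      using tychonoff_separate[OF assms, of "topspace X - U" x] x(2) xX U by blast
    let ?V = "{b \<in> topspace (free_top X). ext f b \<in> {0<..}}"
    have "openin (free_top X) ?V"
      by (rule openin_continuous_map_preimage[OF continuous_map_ext[OF f(1)]]) simp
    then have "openin (subtopology (free_top X) (e ` topspace X)) (e ` topspace X \<inter> ?V)"
      by (rule openin_subtopology_Int2)
    moreover have "a \<in> e ` topspace X \<inter> ?V" using x xX f(3) by (auto simp: e_in_carrier)
    moreover have "e ` topspace X \<inter> ?V \<subseteq> e ` U"
    proof
      fix b assume "b \<in> e ` topspace X \<inter> ?V"
      then obtain y where y: "b = e y" "y \<in> topspace X" "f y > 0" by auto
      then have "y \<in> U" using f(4)[of y] by auto
      with y(1) show "b \<in> e ` U" by blast
    qed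
    ultimately show "\<exists>T. openin (subtopology (free_top X) (e ` topspace X)) T \<and> a \<in> T \<and> T \<subseteq> e ` U"
      by blast
  qed
qed

lemma compactin_vimage_e:
  assumes "tychonoff_space X" "compactin (free_top X) C"
  shows "compactin X {x \<in> topspace X. e x \<in> C}"
proof -
  let ?S = "subtopology (free_top X) (e ` topspace X)"
  have "homeomorphic_map X ?S e" using embedding_map_e[OF assms(1)] by (simp add: embedding_map_def)
  moreover have "compactin ?S (e ` {x \<in> topspace X. e x \<in> C})"
  proof -
    have "compactin (free_top X) (e ` topspace X \<inter> C)"
      by (rule closed_Int_compactin[OF closedin_range_e[OF assms(1)] assms(2)])
    moreover have "e ` {x \<in> topspace X. e x \<in> C} = e ` topspace X \<inter> C" by auto
    ultimately show ?thesis by (simp add: compactin_subtopology)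
  qed
  ultimately show ?thesis using homeomorphic_map_compactness by fastforce
qed

lemma k_space_generators:
  assumes "tychonoff_space X" "k_space (free_top X)"
  shows "k_space X"
proof -
  have "k_space (subtopology (free_top X) (e ` topspace X))"
    by (rule k_space_closed_subtopology[OF assms(2) closedin_range_e[OF assms(1)]])
  moreover have "X homeomorphic_space subtopology (free_top X) (e ` topspace X)"
    using embedding_map_e[OF assms(1)] by (simp add: embedding_map_def homeomorphic_map_imp_homeomorphic_space)
  ultimately show ?thesis by (simp add: homeomorphic_k_space)
qed

lemma second_countable_closure_sequence:
  assumes "second_countable Y" "l \<in> Y closure_of S"
  obtains z :: "nat \<Rightarrow> 'a" where "\<And>n. z n \<in> S" "limitin Y z l sequentially"
proof -
  have l: "l \<in> topspace Y" using assms(2) closure_of_subset_topspace[of Y S] by blast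
  obtain B where B: "countable B" "\<And>V. V \<in> B \<Longrightarrow> openin Y V"
    "\<And>U x. openin Y U \<Longrightarrow> x \<in> U \<Longrightarrow> \<exists>V\<in>B. x \<in> V \<and> V \<subseteq> U"
    using assms(1) unfolding second_countable_def by (elim exE conjE) (rule that, auto)
  let ?B = "{V \<in> B. l \<in> V}"
  have "?B \<noteq> {}" using B(3)[OF openin_topspace l] by blast
  moreover have "countable ?B" using B(1) by simp
  ultimately have rb: "range (from_nat_into ?B) = ?B" by (rule range_from_nat_into)
  define b where "b = from_nat_into ?B"
  have b: "openin Y (b i)" "l \<in> b i" for i
    using rb B(2) unfolding b_def by blast+
  have "\<exists>z. z \<in> S \<and> z \<in> (\<Inter>i\<in>{..n}. b i)" for n
  proof -
    have "openin Y (\<Inter>i\<in>{..n}. b i)" by (intro openin_INT2) (use b in auto)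
    moreover have "l \<in> (\<Inter>i\<in>{..n}. b i)" using b by blast
    ultimately show ?thesis using assms(2) unfolding in_closure_of by blast
  qed
  then have "\<exists>z. \<forall>n. z n \<in> S \<and> z n \<in> (\<Inter>i\<in>{..n}. b i)" by (intro choice allI)
  then obtain z where z: "\<And>n. z n \<in> S" "\<And>n. z n \<in> (\<Inter>i\<in>{..n}. b i)" by blast
  have "limitin Y z l sequentially"
    unfolding limitin_sequentially
  proof (intro conjI allI impI l)
    fix U assume "openin Y U \<and> l \<in> U"
    then obtain V where "V \<in> ?B" "V \<subseteq> U" using B(3) by blast
    then have "V \<in> range b" using rb unfolding b_def by simp
    then obtain i where "b i \<subseteq> U" using \<open>V \<subseteq> U\<close> by blast
    then show "\<exists>N. \<forall>n\<ge>N. z n \<in> U" using z(2) by (intro exI[of _ i]) blast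
  qed
  with z(1) show ?thesis by (rule that)
qed

section \<open>Consequences of a G-base in a k-space\<close>

locale k_space_G_base =
  fixes X :: "'a topology" and U :: "(nat \<Rightarrow> nat) \<Rightarrow> ('a \<Rightarrow> int) set"
  assumes tychonoff: "tychonoff_space X"
    and k_space_A: "k_space (free_top X)"
    and nbhd: "\<exists>V. openin (free_top X) V \<and> 0 \<in> V \<and> V \<subseteq> U \<alpha>"
    and base: "openin (free_top X) W \<Longrightarrow> 0 \<in> W \<Longrightarrow> \<exists>\<alpha>. U \<alpha> \<subseteq> W"
    and anti: "(\<And>i. \<alpha> i \<le> \<beta> i) \<Longrightarrow> U \<beta> \<subseteq> U \<alpha>"
begin

sublocale A: abelian_group_topology "free_top X"
  by (rule abelian_group_topology_free_top)

lemma Hausdorff_A: "Hausdorff_space (free_top X)"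
  by (rule Hausdorff_space_free_top[OF tychonoff])

text \<open>Otherwise some sequence in \<open>P\<close> has all its later-minus-earlier differences
  outside \<open>U \<alpha>\<close>. Infinitely many terms lie in a compact set, which is covered by
  finitely many translates of a \<open>V\<close> with \<open>V - V\<close> inside
  \<open>U \<alpha>\<close>; two terms share a translate.\<close>

lemma precompact:
  assumes "P \<subseteq> topspace X" "seq_rel_compact X P"
  shows "\<exists>Z. finite Z \<and> Z \<subseteq> P \<and> (\<forall>x\<in>P. \<exists>z\<in>Z. e x - e z \<in> U \<alpha>)"
proof (rule ccontr)
  assume no: "\<nexists>Z. finite Z \<and> Z \<subseteq> P \<and> (\<forall>x\<in>P. \<exists>z\<in>Z. e x - e z \<in> U \<alpha>)"
  have step: "\<exists>x\<in>P. x \<in> P \<and> (\<forall>z\<in>Z. e x - e z \<notin> U \<alpha>)" if "finite Z" "Z \<subseteq> P" for n :: nat and Z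
  proof -
    have "\<not> (\<forall>x\<in>P. \<exists>z\<in>Z. e x - e z \<in> U \<alpha>)" using no that by simp
    then show ?thesis by auto
  qed
  have "\<exists>x :: nat \<Rightarrow> 'a. (\<forall>n. x n \<in> P) \<and> (\<forall>n m. m < n \<longrightarrow> e (x n) - e (x m) \<notin> U \<alpha>)"
  proof (rule avoiding_sequence[of P "\<lambda>_ x. x \<in> P" "\<lambda>z x. e x - e z \<notin> U \<alpha>"])
    show "\<exists>x\<in>P. x \<in> P \<and> (\<forall>z\<in>Z. e x - e z \<notin> U \<alpha>)" if "finite Z" "Z \<subseteq> P" for n :: nat and Z
      using that by (rule step)
    fix f :: "nat \<Rightarrow> 'a"
    assume "\<And>n. f n \<in> P" "\<And>m n. m < n \<Longrightarrow> e (f n) - e (f m) \<notin> U \<alpha>"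
    then show "\<exists>x :: nat \<Rightarrow> 'a. (\<forall>n. x n \<in> P) \<and> (\<forall>n m. m < n \<longrightarrow> e (x n) - e (x m) \<notin> U \<alpha>)"
      by (intro exI[of _ f]) simp
  qed
  then obtain x :: "nat \<Rightarrow> 'a" where x: "\<And>n. x n \<in> P" "\<And>m n. m < n \<Longrightarrow> e (x n) - e (x m) \<notin> U \<alpha>"
    by blast
  obtain W where W: "openin (free_top X) W" "0 \<in> W" "W \<subseteq> U \<alpha>" using nbhd by blast
  obtain V where V: "openin (free_top X) V" "0 \<in> V" "V \<subseteq> W"
    "\<And>a b. a \<in> V \<Longrightarrow> b \<in> V \<Longrightarrow> a + b \<in> W \<and> a - b \<in> W"
    by (rule A.half_neighbourhood[OF W(1,2)], rule that) simp_all
  obtain C where C: "compactin X C" "infinite {n \<in> UNIV. x n \<in> C}"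
    by (rule seq_rel_compactD[OF assms(2), of UNIV x]) (use x in auto)
  have CX: "C \<subseteq> topspace X" using C(1) compactin_subset_topspace by blast
  let ?T = "\<lambda>c. {b \<in> topspace (free_top X). b - e c \<in> V}"
  have "compactin (free_top X) (e ` C)" by (rule image_compactin[OF C(1) continuous_map_e])
  moreover have "openin (free_top X) S" if S: "S \<in> ?T ` C" for S
  proof -
    obtain c where "c \<in> C" "S = ?T c" using S by blast
    moreover from this have "e c \<in> topspace (free_top X)" using CX by (auto intro: e_in_carrier)
    ultimately show ?thesis using A.openin_translation[OF V(1), of "e c"] by simp
  qed
  moreover have "e ` C \<subseteq> \<Union> (?T ` C)"
  proof clarify
    fix c assume c: "c \<in> C"
    then have "e c \<in> ?T c" using CX V(2) by (auto simp: e_in_carrier)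
    with c show "e c \<in> \<Union> (?T ` C)" by blast
  qed
  ultimately obtain \<F> where \<F>: "finite \<F>" "\<F> \<subseteq> ?T ` C" "e ` C \<subseteq> \<Union>\<F>"
    using compactinD[of "free_top X" "e ` C" "?T ` C"] by blast
  define \<phi> where "\<phi> n = (SOME S. S \<in> \<F> \<and> e (x n) \<in> S)" for n
  have \<phi>: "\<phi> n \<in> \<F> \<and> e (x n) \<in> \<phi> n" if "n \<in> {n \<in> UNIV. x n \<in> C}" for n
    unfolding \<phi>_def by (rule someI_ex) (use that \<F>(3) in blast)
  have "\<not> inj_on \<phi> {n \<in> UNIV. x n \<in> C}"
  proof
    assume "inj_on \<phi> {n \<in> UNIV. x n \<in> C}"
    moreover have "finite (\<phi> ` {n \<in> UNIV. x n \<in> C})"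
      by (rule finite_subset[OF _ \<F>(1)]) (use \<phi> in blast)
    ultimately show False using C(2) finite_imageD by blast
  qed
  then obtain m n where mn: "m \<in> {n \<in> UNIV. x n \<in> C}" "n \<in> {n \<in> UNIV. x n \<in> C}" "m < n" "\<phi> m = \<phi> n"
    unfolding inj_on_def by (metis (no_types, lifting) linorder_neqE_nat)
  obtain c where "\<phi> n = ?T c" using \<phi>[OF mn(2)] \<F>(2) by blast
  then have "e (x n) - e c \<in> V" "e (x m) - e c \<in> V"
    using \<phi>[OF mn(1)] \<phi>[OF mn(2)] mn(4) by auto
  then have "(e (x n) - e c) - (e (x m) - e c) \<in> W" using V(4) by blast
  then have "e (x n) - e (x m) \<in> U \<alpha>" using W(3) by auto
  with x(2)[OF mn(3)] show False by blast
qed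

text \<open>Differences in \<open>U \<alpha>\<close> act as entourages on \<open>X\<close>. Every
  continuous \<open>f\<close> is uniform for them, since \<open>ext f\<close> is a continuous
  homomorphism and so is small on some \<open>U \<alpha>\<close>.\<close>

lemma approximated_set:
  assumes "P \<subseteq> topspace X" "seq_rel_compact X P"
  obtains F where "approximated_set X P F"
proof -
  define E where "E \<alpha> = {(x, y). x \<in> topspace X \<and> y \<in> topspace X \<and> e x - e y \<in> U \<alpha>}" for \<alpha>
  define \<F> where "\<F> = {f. continuous_map X euclideanreal f \<and> (\<forall>x\<in>topspace X. f x \<in> {0..1})}"
  \<comment> \<open>The value \<open>1/12\<close> turns the bound \<open>3 * \<epsilon>\<close> into
    the \<open>1/4\<close> of the locale.\<close>
  have "\<exists>F. countable F \<and> F \<subseteq> \<F> \<and> (\<forall>f\<in>\<F>. \<exists>g\<in>F. \<forall>x\<in>P. \<bar>f x - g x\<bar> \<le> 3 * (1/12))"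
  proof (rule countable_approximation[of _ E])
    show "E \<beta> \<subseteq> E \<alpha>" if le: "\<And>i. \<alpha> i \<le> \<beta> i" for \<alpha> \<beta>
      using anti[of \<alpha> \<beta>, OF le] unfolding E_def by blast
    show "\<exists>Z. finite Z \<and> Z \<subseteq> P \<and> (\<forall>x\<in>P. \<exists>z\<in>Z. (x, z) \<in> E \<alpha>)" for \<alpha>
    proof -
      obtain Z where Z: "finite Z" "Z \<subseteq> P" "\<And>x. x \<in> P \<Longrightarrow> \<exists>z\<in>Z. e x - e z \<in> U \<alpha>"
        using precompact[OF assms, of \<alpha>] by blast
      have "\<exists>z\<in>Z. (x, z) \<in> E \<alpha>" if "x \<in> P" for x
      proof -
        obtain z where z: "z \<in> Z" "e x - e z \<in> U \<alpha>" using Z(3)[OF \<open>x \<in> P\<close>] by blast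
        then have "(x, z) \<in> E \<alpha>" using \<open>x \<in> P\<close> Z(2) assms(1) by (auto simp: E_def)
        with z(1) show ?thesis by blast
      qed
      with Z(1,2) show ?thesis by blast
    qed
    show "f x \<in> {0..1}" if "f \<in> \<F>" "x \<in> P" for f x
      using that assms(1) unfolding \<F>_def by blast
    show "\<exists>\<alpha>. \<forall>x y. (x, y) \<in> E \<alpha> \<longrightarrow> \<bar>f x - f y\<bar> \<le> 1/12" if "f \<in> \<F>" for f
    proof -
      have f: "continuous_map X euclideanreal f" using that by (simp add: \<F>_def)
      let ?W = "{a \<in> topspace (free_top X). ext f a \<in> {-1/12<..<1/12}}"
      have "openin (free_top X) ?W"
        by (rule openin_continuous_map_preimage[OF continuous_map_ext[OF f]]) simp
      moreover have "0 \<in> ?W" using zero_in_carrier by simp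
      ultimately obtain \<alpha> where \<alpha>: "U \<alpha> \<subseteq> ?W" using base by blast
      have "\<bar>f x - f y\<bar> \<le> 1/12" if "(x, y) \<in> E \<alpha>" for x y
      proof -
        have xy: "x \<in> topspace X" "y \<in> topspace X" "e x - e y \<in> U \<alpha>"
          using that by (auto simp: E_def)
        then have "ext f (e x - e y) \<in> {-1/12<..<1/12}" using \<alpha> by blast
        then have "-1/12 < f x - f y" "f x - f y < 1/12"
          using ext_diff[OF e_in_carrier[OF xy(1)] e_in_carrier[OF xy(2)], of f] by simp_all
        then show ?thesis by linarith
      qed
      then show ?thesis by blast
    qed
  qed simp
  then obtain F where F: "countable F" "F \<subseteq> \<F>"
    "\<And>f. f \<in> \<F> \<Longrightarrow> \<exists>g\<in>F. \<forall>x\<in>P. \<bar>f x - g x\<bar> \<le> 1/4" by auto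
  have "approximated_set X P F"
  proof
    show "\<exists>g\<in>F. \<forall>x\<in>P. \<bar>f x - g x\<bar> \<le> 1/4"
      if "continuous_map X euclideanreal f" "\<And>x. x \<in> topspace X \<Longrightarrow> f x \<in> {0..1}" for f
      by (rule F(3)) (use that in \<open>auto simp: \<F>_def\<close>)
    show "continuous_map X euclideanreal g" if "g \<in> F" for g
      using F(2) that by (auto simp: \<F>_def)
  qed (fact tychonoff assms F(1))+
  then show ?thesis by (rule that)
qed

lemma Hausdorff_X: "Hausdorff_space X"
  using tychonoff unfolding tychonoff_space_def
  by (metis completely_regular_imp_regular_space regular_t1_imp_Hausdorff_space)

text \<open>\<open>X\<close> inherits the k-property as a closed subspace of A(X), so closedness is
  tested on compact sets. These are second countable, being approximated sets equal to their
  closure, and there sequences decide.\<close>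

lemma closedin_sequentiallyI:
  assumes S: "S \<subseteq> topspace X"
    and lim: "\<And>z l. (\<And>n. z n \<in> S) \<Longrightarrow> limitin X z l sequentially \<Longrightarrow> l \<in> S"
  shows "closedin X S"
proof -
  have "closedin (subtopology X K) (K \<inter> S)" if K: "compactin X K" for K
  proof -
    have KX: "K \<subseteq> topspace X" using K compactin_subset_topspace by blast
    obtain F where "approximated_set X K F"
      using approximated_set[OF KX compactin_imp_seq_rel_compact[OF K]] by blast
    then interpret approximated_set X K F .
    have "X closure_of K = K"
      using compactin_imp_closedin[OF Hausdorff_X K] by (simp add: closure_of_eq)
    then have sc: "second_countable (subtopology X K)" using second_countable_closure by simp
    have "subtopology X K closure_of (K \<inter> S) \<subseteq> K \<inter> S"
    proof
      fix l assume "l \<in> subtopology X K closure_of (K \<inter> S)"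
      then obtain z where z: "\<And>n. z n \<in> K \<inter> S" "limitin (subtopology X K) z l sequentially"
        using second_countable_closure_sequence[OF sc] by blast
      then have "l \<in> K" "limitin X z l sequentially" by (auto simp: limitin_subtopology)
      with lim[of z l] z(1) show "l \<in> K \<inter> S" by blast
    qed
    moreover have "K \<inter> S \<subseteq> topspace (subtopology X K)" using KX by auto
    ultimately show ?thesis using closure_of_subset_eq by blast
  qed
  then show ?thesis using k_space_generators[OF tychonoff k_space_A] S unfolding k_space by blast
qed

section \<open>Intersections of the G-base over the extensions of a finite word\<close>

definition D :: "nat list \<Rightarrow> ('a \<Rightarrow> int) set" where
  "D s = \<Inter> (U ` {b. \<forall>i<length s. b i = s ! i})"

lemma D_subset_U: "D (map \<alpha> [0..<k]) \<subseteq> U \<alpha>"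
  unfolding D_def by (rule INT_lower) simp

text \<open>Longer words have fewer extensions, so fewer sets are intersected.\<close>

lemma D_mono: "k \<le> l \<Longrightarrow> D (map \<alpha> [0..<k]) \<subseteq> D (map \<alpha> [0..<l])"
  unfolding D_def by (rule INF_superset_mono) auto

text \<open>If every prefix failed, there would be terms arbitrarily far out that avoid sets
  \<open>U b\<close> with \<open>b\<close> agreeing with \<open>\<alpha>\<close> ever longer. One
  \<open>\<beta>\<close> dominates these \<open>b\<close>, and the neighbourhood
  \<open>U \<beta>\<close> inside all the \<open>U b\<close> contains a tail of the
  sequence.\<close>

lemma eventually_in_D:
  assumes "limitin (free_top X) a 0 sequentially"
  obtains k m where "\<And>i. i \<ge> m \<Longrightarrow> a i \<in> D (map \<alpha> [0..<k])"
proof (rule ccontr)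
  assume no: "\<not> thesis"
  have "\<exists>p. fst p \<ge> k \<and> (\<forall>i<k. snd p i = \<alpha> i) \<and> a (fst p) \<notin> U (snd p)" for k
  proof -
    have "\<exists>i\<ge>k. a i \<notin> D (map \<alpha> [0..<k])" using no that by blast
    then obtain i where "i \<ge> k" "a i \<notin> D (map \<alpha> [0..<k])" by blast
    then obtain b where "\<forall>j<k. b j = \<alpha> j" "a i \<notin> U b" unfolding D_def by auto
    with \<open>i \<ge> k\<close> show ?thesis by (intro exI[of _ "(i, b)"]) simp
  qed
  then have "\<exists>p. \<forall>k. fst (p k) \<ge> k \<and> (\<forall>i<k. snd (p k) i = \<alpha> i) \<and> a (fst (p k)) \<notin> U (snd (p k))"
    by (intro choice allI)
  then obtain p where p: "\<And>k. fst (p k) \<ge> k" "\<And>k i. i < k \<Longrightarrow> snd (p k) i = \<alpha> i"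
    "\<And>k. a (fst (p k)) \<notin> U (snd (p k))" by blast
  obtain \<beta> where \<beta>: "\<And>k i. snd (p k) i \<le> \<beta> i"
    using dominating_sequence[of "\<lambda>k. snd (p k)" \<alpha>] p(2) by blast
  obtain V where V: "openin (free_top X) V" "0 \<in> V" "V \<subseteq> U \<beta>" using nbhd by blast
  then obtain N where N: "\<And>i. i \<ge> N \<Longrightarrow> a i \<in> V"
    using assms unfolding limitin_sequentially by blast
  have "a (fst (p N)) \<in> V" using N p(1) by blast
  with V(3) anti[of "snd (p N)" \<beta>] \<beta> p(3)[of N] show False by blast
qed

end

section \<open>Sequences escaping compact sets, weighted sums, integer multiples\<close>

lemma not_seq_rel_compactE:
  assumes "\<not> seq_rel_compact Y P"
  obtains \<tau> :: "nat \<Rightarrow> 'b" where "\<And>j. \<tau> j \<in> P" "\<And>C. compactin Y C \<Longrightarrow> finite {j. \<tau> j \<in> C}"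
proof -
  obtain \<sigma> :: "nat \<Rightarrow> 'b" and N where N: "infinite N" "\<sigma> ` N \<subseteq> P"
    "\<And>C. compactin Y C \<Longrightarrow> finite {n \<in> N. \<sigma> n \<in> C}"
    using assms unfolding seq_rel_compact_def by blast
  show ?thesis
  proof (rule that[of "\<lambda>j. \<sigma> (enumerate N j)"])
    show "\<sigma> (enumerate N j) \<in> P" for j
      using N(2) enumerate_in_set[OF N(1), of j] by blast
    fix C assume "compactin Y C"
    have "enumerate N ` {j. \<sigma> (enumerate N j) \<in> C} \<subseteq> {n \<in> N. \<sigma> n \<in> C}"
      using enumerate_in_set[OF N(1)] by auto
    then have "finite (enumerate N ` {j. \<sigma> (enumerate N j) \<in> C})"
      using N(3)[OF \<open>compactin Y C\<close>] by (rule finite_subset)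
    moreover have "inj (enumerate N)"
      using strict_mono_enumerate[OF N(1)] by (rule strict_mono_imp_inj_on)
    ultimately show "finite {j. \<sigma> (enumerate N j) \<in> C}"
      by (metis (no_types, lifting) finite_imageD inj_on_subset subset_UNIV)
  qed
qed

lemma seq_rel_compact_image:
  fixes E :: "'b set" and g :: "'b \<Rightarrow> 'c"
  assumes "seq_rel_compact Y E" "continuous_map Y Z g"
  shows "seq_rel_compact Z (g ` E)"
  unfolding seq_rel_compact_def
proof (intro allI impI)
  fix \<sigma> :: "nat \<Rightarrow> 'c" and N assume N: "infinite N \<and> \<sigma> ` N \<subseteq> g ` E"
  define \<tau> where "\<tau> n = (SOME y. y \<in> E \<and> \<sigma> n = g y)" for n
  have \<tau>: "\<tau> n \<in> E \<and> \<sigma> n = g (\<tau> n)" if "n \<in> N" for n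
    unfolding \<tau>_def by (rule someI_ex) (use N that in blast)
  obtain C where C: "compactin Y C" "infinite {n \<in> N. \<tau> n \<in> C}"
    by (rule seq_rel_compactD[OF assms(1), of N \<tau>]) (use N \<tau> in auto)
  have "{n \<in> N. \<tau> n \<in> C} \<subseteq> {n \<in> N. \<sigma> n \<in> g ` C}" using \<tau> by auto
  then have "infinite {n \<in> N. \<sigma> n \<in> g ` C}" using C(2) finite_subset by blast
  moreover have "compactin Z (g ` C)" by (rule image_compactin[OF C(1) assms(2)])
  ultimately show "\<exists>C. compactin Z C \<and> infinite {n \<in> N. \<sigma> n \<in> C}" by blast
qed

lemma continuous_map_weighted_suminf:
  fixes h :: "nat \<Rightarrow> 'a \<Rightarrow> real"
  assumes "\<And>n. continuous_map X euclideanreal (h n)"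
    and "\<And>n y. y \<in> topspace X \<Longrightarrow> h n y \<in> {0..1}"
  shows "continuous_map X euclideanreal (\<lambda>y. \<Sum>n. (1/2) ^ n * h n y)"
proof -
  let ?s = "\<lambda>N y. \<Sum>n<N. (1/2) ^ n * h n y"
  have "uniform_limit (topspace X) ?s (\<lambda>y. \<Sum>n. (1/2) ^ n * h n y) sequentially"
    by (rule Weierstrass_m_test[where M = "\<lambda>n. (1/2) ^ n"]) (use assms(2) in \<open>auto simp: abs_mult mult_left_le\<close>)
  then have lim: "\<forall>\<^sub>F N in sequentially. \<forall>y\<in>topspace X.
      (\<Sum>n. (1/2) ^ n * h n y) \<in> UNIV \<and> dist (?s N y) (\<Sum>n. (1/2) ^ n * h n y) < \<epsilon>" if "\<epsilon> > 0" for \<epsilon>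
    using uniform_limitD[OF _ that] by simp
  have "continuous_map X euclideanreal (?s N)" for N
    by (intro continuous_map_sum continuous_map_real_mult_left assms(1)) simp
  then have "continuous_map X Met_TC.mtopology (\<lambda>y. \<Sum>n. (1/2) ^ n * h n y)"
    by (intro Met_TC.continuous_map_uniform_limit[where F = sequentially and f = ?s, OF _ lim])
       (simp_all add: mtopology_is_euclidean)
  then show ?thesis by (simp add: mtopology_is_euclidean)
qed

text \<open>In the pointwise ring of functions \<open>of_nat c\<close> is the constant function
  \<open>c\<close>, so \<open>of_nat c * a\<close> is the \<open>c\<close>-fold sum of
  \<open>a\<close>.\<close>

lemma of_nat_mult_in_carrier: "a \<in> free_ab_carrier X \<Longrightarrow> of_nat c * a \<in> free_ab_carrier X"
proof -
  have "{x. (of_nat c * a) x \<noteq> 0} \<subseteq> {x. a x \<noteq> 0}" by auto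
  then show "a \<in> free_ab_carrier X \<Longrightarrow> of_nat c * a \<in> free_ab_carrier X"
    unfolding free_ab_carrier_def using finite_subset by blast
qed

lemma ext_of_nat_mult:
  assumes "a \<in> free_ab_carrier X" shows "ext f (of_nat c * a) = real c * ext f a"
proof -
  have "ext f (of_nat c * a) = (\<Sum>x | a x \<noteq> 0. of_int ((of_nat c * a) x) * f x)"
    by (rule ext_superset) (use assms in \<open>auto simp: free_ab_carrier_def\<close>)
  also have "\<dots> = real c * ext f a"
    unfolding ext_def sum_distrib_left by (rule sum.cong) auto
  finally show ?thesis .
qed

lemma continuous_map_of_nat_mult:
  assumes "continuous_map Y (free_top X) f"
  shows "continuous_map Y (free_top X) (\<lambda>y. of_nat c * f y)"
proof -
  interpret abelian_group_topology "free_top X" by (rule abelian_group_topology_free_top)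
  show ?thesis
  proof (induction c)
    case 0
    have "(\<lambda>y. of_nat 0 * f y) = (\<lambda>_. 0)" by (simp add: fun_eq_iff)
    then show ?case by (simp only: continuous_map_const) (simp add: zero_in_carrier)
  next
    case (Suc c)
    have "(\<lambda>y. of_nat (Suc c) * f y) = (\<lambda>y. f y + of_nat c * f y)"
      by (simp add: fun_eq_iff distrib_right)
    then show ?case using continuous_map_plus[OF assms Suc] by (simp only:)
  qed
qed

lemma limitin_e_diff:
  assumes "limitin X x l sequentially"
  shows "limitin (free_top X) (\<lambda>j. of_nat c * (e (x j) - e l)) 0 sequentially"
proof -
  interpret abelian_group_topology "free_top X" by (rule abelian_group_topology_free_top)
  have l: "l \<in> topspace X" by (rule limitin_topspace[OF assms])
  have "continuous_map X (free_top X) (\<lambda>_. e l)" using e_in_carrier[OF l] by simp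
  then have "continuous_map X (free_top X) (\<lambda>y. of_nat c * (e y - e l))"
    by (intro continuous_map_of_nat_mult continuous_map_minus continuous_map_e)
  from continuous_map_limit[OF this assms]
  have "limitin (free_top X) (\<lambda>j. of_nat c * (e (x j) - e l)) (of_nat c * (e l - e l)) sequentially"
    by (simp only: o_def)
  then show ?thesis by (simp only: diff_self mult_zero_right)
qed

section \<open>Differences of points and the choice of a good index\<close>

context k_space_G_base
begin

definition differences :: "('a \<Rightarrow> int) set" where
  "differences = (\<lambda>p. e (fst p) - e (snd p)) ` (topspace X \<times> topspace X)"

lemma differencesE:
  assumes "d \<in> differences"
  obtains y z where "y \<in> topspace X" "z \<in> topspace X" "d = e y - e z"
  using assms unfolding differences_def by auto

lemma differences_subset: "differences \<subseteq> free_ab_carrier X"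
  unfolding differences_def by (auto intro!: diff_in_carrier e_in_carrier)

text \<open>The functional \<open>\<Sum>n. 2\<^sup>-\<^sup>n h n\<close> with \<open>h n\<close> equal to \<open>1\<close> at \<open>x (i n)\<close> and \<open>0\<close> at \<open>l\<close> takes values of order at
  least \<open>2\<^sup>n\<close> on the elements in question, so it is unbounded on an infinite family of them.\<close>

lemma finite_indices:
  fixes x :: "nat \<Rightarrow> 'a" and i :: "nat \<Rightarrow> nat"
  assumes x: "\<And>j. x j \<in> topspace X" "\<And>j. x j \<noteq> l" "l \<in> topspace X"
    and C: "compactin (free_top X) C"
    and T: "\<And>n. n \<in> T \<Longrightarrow> d n \<in> differences"
      "\<And>n. n \<in> T \<Longrightarrow> d n + of_nat (4 ^ Suc n) * (e (x (i n)) - e l) \<in> C"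
  shows "finite T"
proof -
  have "\<exists>h. continuous_map X euclideanreal h \<and> (\<forall>y\<in>topspace X. h y \<in> {0..1}) \<and> h (x (i n)) = 1 \<and> h l = 0" for n
  proof -
    have "closedin X {l}" using tychonoff_closedin_finite[OF tychonoff] x(3) by simp
    then obtain h :: "'a \<Rightarrow> real" where "continuous_map X euclideanreal h"
      "\<And>y. y \<in> topspace X \<Longrightarrow> h y \<in> {0..1}" "h (x (i n)) = 1" "\<And>y. y \<in> {l} \<Longrightarrow> h y = 0"
      using tychonoff_separate[OF tychonoff _ x(1), of "{l}" "i n"] x(2)[of "i n"] by blast
    then show ?thesis by blast
  qed
  then have "\<exists>h. \<forall>n. continuous_map X euclideanreal (h n) \<and> (\<forall>y\<in>topspace X. h n y \<in> {0..1}) \<and>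
    h n (x (i n)) = 1 \<and> h n l = 0" by (intro choice allI)
  then obtain h :: "nat \<Rightarrow> 'a \<Rightarrow> real" where h: "\<And>n. continuous_map X euclideanreal (h n)"
    "\<And>n y. y \<in> topspace X \<Longrightarrow> h n y \<in> {0..1}" "\<And>n. h n (x (i n)) = 1" "\<And>n. h n l = 0" by blast
  define f where "f y = (\<Sum>n. (1/2) ^ n * h n y)" for y
  have fc: "continuous_map X euclideanreal f"
    unfolding f_def by (rule continuous_map_weighted_suminf[OF h(1,2)])
  have term_le: "(1/2) ^ n * h n y \<le> (1/2) ^ n" "0 \<le> (1/2) ^ n * h n y" if "y \<in> topspace X" for n y
    using h(2)[OF that, of n] by (auto simp: mult_left_le)
  have sm: "summable (\<lambda>n. (1/2) ^ n * h n y)" if "y \<in> topspace X" for y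
    by (rule summable_comparison_test'[of "\<lambda>n. (1/2) ^ n" 0]) (simp_all only: real_norm_def abs_of_nonneg[OF term_le(2)[OF that]] term_le(1)[OF that], simp)
  have f_bd: "0 \<le> f y" "f y \<le> 2" if "y \<in> topspace X" for y
  proof -
    show "0 \<le> f y" unfolding f_def by (rule suminf_nonneg[OF sm[OF that] term_le(2)[OF that]])
    have "f y \<le> (\<Sum>n. (1/2) ^ n)"
      unfolding f_def by (rule suminf_le[OF term_le(1)[OF that] sm[OF that]]) simp
    then show "f y \<le> 2" by (simp add: suminf_geometric)
  qed
  have f_l: "f l = 0" unfolding f_def by (simp add: h(4))
  have f_x: "(1/2) ^ n \<le> f (x (i n))" for n
  proof -
    have "(\<Sum>m\<in>{n}. (1/2) ^ m * h m (x (i n))) \<le> f (x (i n))"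
      unfolding f_def by (rule sum_le_suminf[OF sm[OF x(1)]]) (use term_le(2)[OF x(1)] in auto)
    then show ?thesis by (simp add: h(3))
  qed
  have "compactin euclideanreal (ext f ` C)"
    by (rule image_compactin[OF C continuous_map_ext[OF fc]])
  then have "bounded (ext f ` C)" by (simp add: compact_imp_bounded)
  then obtain B where B: "\<And>a. a \<in> C \<Longrightarrow> \<bar>ext f a\<bar> \<le> B" by (auto simp: bounded_iff)
  \<comment> \<open>\<open>f\<close> takes values between 0 and 2, so the difference
    \<open>d n\<close> contributes at least \<open>-2\<close>; the multiple contributes at least
    \<open>4 ^ Suc n * (1/2) ^ n = 4 * 2 ^ n\<close>.\<close>
  have bound: "2 ^ n \<le> B + 2" if n: "n \<in> T" for n
  proof -
    obtain y z where yz: "y \<in> topspace X" "z \<in> topspace X" "d n = e y - e z"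
      by (rule differencesE[OF T(1)[OF n]])
    have c: "e (x (i n)) \<in> free_ab_carrier X" "e l \<in> free_ab_carrier X"
      "e y \<in> free_ab_carrier X" "e z \<in> free_ab_carrier X"
      using x yz by (auto intro: e_in_carrier)
    have "ext f (d n + of_nat (4 ^ Suc n) * (e (x (i n)) - e l))
      = ext f (d n) + ext f (of_nat (4 ^ Suc n) * (e (x (i n)) - e l))"
      by (rule ext_add[of _ X, OF subsetD[OF differences_subset T(1)[OF n]]])
         (intro of_nat_mult_in_carrier diff_in_carrier c)
    also have "ext f (d n) = f y - f z"
      unfolding yz(3) by (simp only: ext_diff[OF c(3,4)] ext_e)
    also have "ext f (of_nat (4 ^ Suc n) * (e (x (i n)) - e l)) = real (4 ^ Suc n) * f (x (i n))"
      by (simp only: ext_of_nat_mult[OF diff_in_carrier[OF c(1,2)]] ext_diff[OF c(1,2)] ext_e f_l diff_0_right)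
    finally have "f y - f z + real (4 ^ Suc n) * f (x (i n)) \<le> B"
      using B[OF T(2)[OF n]] by linarith
    moreover have "real (4 ^ Suc n) * (1/2) ^ n \<le> real (4 ^ Suc n) * f (x (i n))"
      by (rule mult_left_mono[OF f_x]) simp
    moreover have "real (4 ^ Suc n) * (1/2) ^ n = 4 * 2 ^ n"
    proof -
      have "real (4 ^ Suc n) * (1/2) ^ n = 4 * (4 ^ n * (1/2) ^ n)" by simp
      also have "(4::real) ^ n * (1/2) ^ n = 2 ^ n" by (simp flip: power_mult_distrib)
      finally show ?thesis .
    qed
    moreover have "(0::real) \<le> 2 ^ n" by simp
    ultimately show ?thesis using f_bd(1)[OF yz(1)] f_bd(2)[OF yz(2)] by linarith
  qed
  obtain N where N: "B + 2 < 2 ^ N" using real_arch_pow[of 2 "B + 2"] by auto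
  have "n < N" if "n \<in> T" for n
  proof (rule ccontr)
    assume "\<not> n < N"
    then have "(2::real) ^ N \<le> 2 ^ n" by (intro power_increasing) auto
    with N bound[OF that] show False by linarith
  qed
  then show ?thesis by (meson finite_lessThan finite_subset lessThan_iff subsetI)
qed

text \<open>If for every \<open>\<alpha>\<close> some \<open>D (map \<alpha> [0..<k])\<close> contains a sequence of differences that meets each compact
  set finitely often, then adding to these sequences the multiples \<open>4\<^sup>m(x\<^sub>j - l)\<close>, which tend to zero, with \<open>m\<close>
  growing with the word, gives a set that meets every compact set in a finite set but has \<open>0\<close> in its closure.\<close>

lemma exists_small_differences:
  fixes x :: "nat \<Rightarrow> 'a"
  assumes x: "\<And>j. x j \<in> topspace X" "\<And>j. x j \<noteq> l" "limitin X x l sequentially"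
  shows "\<exists>\<alpha>. \<forall>k. seq_rel_compact (free_top X) (D (map \<alpha> [0..<k]) \<inter> differences)"
proof (rule ccontr)
  assume no: "\<nexists>\<alpha>. \<forall>k. seq_rel_compact (free_top X) (D (map \<alpha> [0..<k]) \<inter> differences)"
  have l: "l \<in> topspace X" by (rule limitin_topspace[OF x(3)])
  define Bad where "Bad = {s. \<not> seq_rel_compact (free_top X) (D s \<inter> differences)}"
  have "\<exists>t :: nat \<Rightarrow> 'a \<Rightarrow> int. s \<in> Bad \<longrightarrow> (\<forall>j. t j \<in> D s \<inter> differences) \<and>
      (\<forall>C. compactin (free_top X) C \<longrightarrow> finite {j. t j \<in> C})" for s
  proof (cases "s \<in> Bad")
    case True
    then obtain t :: "nat \<Rightarrow> 'a \<Rightarrow> int" where "\<And>j. t j \<in> D s \<inter> differences"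
      "\<And>C. compactin (free_top X) C \<Longrightarrow> finite {j. t j \<in> C}"
      using not_seq_rel_compactE[of "free_top X" "D s \<inter> differences"] unfolding Bad_def by blast
    then show ?thesis by blast
  qed simp
  then have "\<exists>t. \<forall>s. s \<in> Bad \<longrightarrow> (\<forall>j :: nat. t s j \<in> D s \<inter> differences) \<and>
      (\<forall>C. compactin (free_top X) C \<longrightarrow> finite {j. t s j \<in> C})" by (intro choice allI)
  then obtain t :: "nat list \<Rightarrow> nat \<Rightarrow> 'a \<Rightarrow> int" where
    t: "\<And>s j. s \<in> Bad \<Longrightarrow> t s j \<in> D s \<inter> differences"
      "\<And>s C. s \<in> Bad \<Longrightarrow> compactin (free_top X) C \<Longrightarrow> finite {j. t s j \<in> C}" by blast
  \<comment> \<open>Coding words by \<open>to_nat\<close> gives different words different exponents.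
    \<open>Suc\<close> keeps the coefficient at \<open>x j\<close> at least 4, and a difference of
    two points lowers it by at most 1, so \<open>v s j\<close> is never \<open>0\<close>.\<close>
  define w where "w s j = of_nat (4 ^ Suc (to_nat s)) * (e (x j) - e l)" for s :: "nat list" and j
  define v where "v s j = t s j + w s j" for s j
  define F where "F = {v s j | s j. s \<in> Bad}"
  have w_lim: "limitin (free_top X) (w s) 0 sequentially" for s
    unfolding w_def by (rule limitin_e_diff[OF x(3)])
  have w_in: "w s j \<in> free_ab_carrier X" for s j
    unfolding w_def by (intro of_nat_mult_in_carrier diff_in_carrier e_in_carrier x(1) l)
  have F_sub: "F \<subseteq> topspace (free_top X)"
    unfolding F_def v_def using t(1) differences_subset w_in
    by (auto intro!: add_in_carrier)
  have zero_F: "0 \<notin> F"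
  proof
    assume "0 \<in> F"
    then obtain s j where sj: "s \<in> Bad" "v s j = 0" unfolding F_def by auto
    have "t s j \<in> differences" using t(1)[OF sj(1)] by blast
    then obtain y z where yz: "t s j = e y - e z" using differencesE by metis
    have "t s j (x j) \<ge> -1" unfolding yz by (auto simp: free_ab_unit_def)
    moreover have "w s j (x j) = 4 ^ Suc (to_nat s)" using x(2)[of j]
      unfolding w_def times_fun_apply of_nat_fun_apply by (simp add: free_ab_unit_def)
    moreover have "(4::int) ^ Suc (to_nat s) \<ge> 4" by (simp add: one_le_power)
    moreover have "v s j (x j) = t s j (x j) + w s j (x j)" by (simp only: v_def plus_fun_apply)
    ultimately have "v s j (x j) > 0" by linarith
    with sj(2) show False by simp
  qed
  have fin: "finite (C \<inter> F)" if C: "compactin (free_top X) C" for C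
  proof -
    define J where "J s = {j. v s j \<in> C}" for s
    \<comment> \<open>For a fixed word, \<open>t s j\<close> is a point of \<open>C\<close> minus a
      term of the null sequence \<open>w s\<close>. It thus lies in a compact set, which
      \<open>t s\<close> visits only finitely often.\<close>
    have J_fin: "finite (J s)" if s: "s \<in> Bad" for s
    proof -
      let ?L = "insert 0 (range (w s))"
      have L: "compactin (free_top X) ?L"
        by (rule compactin_sequence_with_limit[OF w_lim[of s]]) (use w_in in auto)
      let ?C = "(\<lambda>p. fst p + snd p) ` (C \<times> uminus ` ?L)"
      have "compactin (free_top X) ?C" by (rule A.compactin_add[OF C A.compactin_neg[OF L]])
      then have "finite {j. t s j \<in> ?C}" by (rule t(2)[OF s])
      moreover have "J s \<subseteq> {j. t s j \<in> ?C}"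
      proof
        fix j assume "j \<in> J s"
        then have "(v s j, - w s j) \<in> C \<times> uminus ` ?L" unfolding J_def by blast
        moreover have "t s j = fst (v s j, - w s j) + snd (v s j, - w s j)" by (simp add: v_def)
        ultimately have "t s j \<in> ?C" by (rule rev_image_eqI)
        then show "j \<in> {j. t s j \<in> ?C}" by simp
      qed
      ultimately show ?thesis by (rule rev_finite_subset)
    qed
    \<comment> \<open>Across words: selecting one hit \<open>j\<close> for each word is enough for
      \<open>finite_indices\<close> to bound the number of words with a hit.\<close>
    define T where "T = {s \<in> Bad. J s \<noteq> {}}"
    have "finite (to_nat ` T)"
    proof (rule finite_indices[where x = x and l = l and C = C and d = "\<lambda>n. t (from_nat n) (SOME j. j \<in> J (from_nat n))"
          and i = "\<lambda>n. SOME j. j \<in> J (from_nat n)"])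
      fix n assume "n \<in> to_nat ` T"
      then obtain s where s: "n = to_nat s" "s \<in> Bad" "J s \<noteq> {}" unfolding T_def by blast
      then have "(SOME j. j \<in> J s) \<in> J s" by (simp add: some_in_eq)
      then have "v s (SOME j. j \<in> J s) \<in> C" unfolding J_def by blast
      then show "t (from_nat n) (SOME j. j \<in> J (from_nat n))
          + of_nat (4 ^ Suc n) * (e (x (SOME j. j \<in> J (from_nat n))) - e l) \<in> C"
        unfolding v_def w_def s(1) from_nat_to_nat .
      show "t (from_nat n) (SOME j. j \<in> J (from_nat n)) \<in> differences"
        unfolding s(1) from_nat_to_nat using t(1)[OF s(2)] by blast
    qed (fact x(1) x(2) l C)+
    then have "finite T" by (rule finite_imageD) simp
    then have "finite (\<Union>s\<in>T. v s ` J s)" using J_fin unfolding T_def by blast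
    moreover have "C \<inter> F \<subseteq> (\<Union>s\<in>T. v s ` J s)" unfolding F_def T_def J_def by auto
    ultimately show ?thesis by (rule rev_finite_subset)
  qed
  have "closedin (free_top X) F"
  proof -
    have "closedin (subtopology (free_top X) C) (C \<inter> F)" if C: "compactin (free_top X) C" for C
    proof (rule closedin_Hausdorff_finite)
      show "Hausdorff_space (subtopology (free_top X) C)"
        by (rule Hausdorff_space_subtopology[OF Hausdorff_A])
      show "C \<inter> F \<subseteq> topspace (subtopology (free_top X) C)" using F_sub by auto
    qed (rule fin[OF C])
    then show ?thesis using k_space_A F_sub unfolding k_space by blast
  qed
  then have W: "openin (free_top X) (topspace (free_top X) - F)" by blast
  have "0 \<in> topspace (free_top X) - F" using zero_F zero_in_carrier by simp
  note half = A.half_neighbourhood[OF W this]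
  obtain V where V: "openin (free_top X) V" "0 \<in> V" "V \<subseteq> topspace (free_top X) - F"
    "\<And>a b. a \<in> V \<Longrightarrow> b \<in> V \<Longrightarrow>
      a + b \<in> topspace (free_top X) - F \<and> a - b \<in> topspace (free_top X) - F"
    by (rule half, rule that) simp_all
  \<comment> \<open>\<open>U \<alpha>\<close> contains \<open>D s\<close> for every prefix
    \<open>s\<close> of \<open>\<alpha>\<close>, in particular for a bad one. Both summands of some
    \<open>v s j\<close> are then in \<open>V\<close>, whose sums avoid \<open>F\<close>.\<close>
  obtain \<alpha> where \<alpha>: "U \<alpha> \<subseteq> V" using base[OF V(1,2)] by blast
  obtain k where k: "map \<alpha> [0..<k] \<in> Bad" using no unfolding Bad_def by blast
  define s where "s = map \<alpha> [0..<k]"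
  obtain j where j: "w s j \<in> V"
    using w_lim[of s] V(1,2) unfolding limitin_sequentially by blast
  have "t s j \<in> D s" using t(1)[of s j] k unfolding s_def by blast
  then have "t s j \<in> V" using D_subset_U[of \<alpha> k] \<alpha> unfolding s_def by blast
  from V(4)[OF this j] have "v s j \<notin> F" unfolding v_def by blast
  moreover have "v s j \<in> F" using k unfolding F_def s_def by blast
  ultimately show False by blast
qed

section \<open>Translation by small differences and the exhausting compact sets\<close>

definition nearby :: "('a \<Rightarrow> int) set \<Rightarrow> 'a set \<Rightarrow> 'a set" where
  "nearby E P = {x \<in> topspace X. \<exists>y\<in>P. e x - e y \<in> E}"

lemma seq_rel_compact_nearby:
  assumes P: "seq_rel_compact X P" and E: "seq_rel_compact (free_top X) E"
  shows "seq_rel_compact X (nearby E P)"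
  unfolding seq_rel_compact_def
proof (intro allI impI)
  fix \<sigma> :: "nat \<Rightarrow> 'a" and N assume N: "infinite N \<and> \<sigma> ` N \<subseteq> nearby E P"
  define y where "y n = (SOME y. y \<in> P \<and> e (\<sigma> n) - e y \<in> E)" for n
  have \<sigma>: "\<sigma> n \<in> nearby E P" if "n \<in> N" for n using N that by blast
  have y: "y n \<in> P \<and> e (\<sigma> n) - e (y n) \<in> E" if "n \<in> N" for n
    unfolding y_def by (rule someI_ex) (use \<sigma>[OF that] in \<open>auto simp: nearby_def\<close>)
  obtain C1 where C1: "compactin X C1" "infinite {n \<in> N. y n \<in> C1}"
    by (rule seq_rel_compactD[OF P, of N y]) (use N y in auto)
  let ?M = "{n \<in> N. y n \<in> C1}"
  obtain C2 where C2: "compactin (free_top X) C2" "infinite {n \<in> ?M. e (\<sigma> n) - e (y n) \<in> C2}"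
    by (rule seq_rel_compactD[OF E C1(2), of "\<lambda>n. e (\<sigma> n) - e (y n)"]) (use y in auto)
  let ?C = "(\<lambda>p. fst p + snd p) ` (C2 \<times> e ` C1)"
  have "compactin (free_top X) ?C"
    by (rule A.compactin_add[OF C2(1) image_compactin[OF C1(1) continuous_map_e]])
  then have "compactin X {x \<in> topspace X. e x \<in> ?C}" by (rule compactin_vimage_e[OF tychonoff])
  moreover have "{n \<in> ?M. e (\<sigma> n) - e (y n) \<in> C2} \<subseteq> {n \<in> N. \<sigma> n \<in> {x \<in> topspace X. e x \<in> ?C}}"
  proof
    fix n assume n: "n \<in> {n \<in> ?M. e (\<sigma> n) - e (y n) \<in> C2}"
    then have "(e (\<sigma> n) - e (y n), e (y n)) \<in> C2 \<times> e ` C1" by blast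
    moreover have "e (\<sigma> n) = fst (e (\<sigma> n) - e (y n), e (y n)) + snd (e (\<sigma> n) - e (y n), e (y n))"
      by simp
    ultimately have "e (\<sigma> n) \<in> ?C" by (rule rev_image_eqI)
    moreover have "\<sigma> n \<in> topspace X" using \<sigma>[of n] n by (auto simp: nearby_def)
    ultimately show "n \<in> {n \<in> N. \<sigma> n \<in> {x \<in> topspace X. e x \<in> ?C}}" using n by blast
  qed
  ultimately show "\<exists>C. compactin X C \<and> infinite {n \<in> N. \<sigma> n \<in> C}"
    using C2(2) finite_subset by blast
qed

text \<open>Both signs are needed: translates by \<open>E n\<close> catch the terms of a sequence
  converging to a point of the chain, translates by the negatives catch the limit of terms in the
  chain. The points \<open>q n\<close> feed in the dense set one at a time.\<close>

primrec chain :: "(nat \<Rightarrow> ('a \<Rightarrow> int) set) \<Rightarrow> (nat \<Rightarrow> 'a) \<Rightarrow> nat \<Rightarrow> 'a set" where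
  "chain E q 0 = {}"
| "chain E q (Suc n) = chain E q n \<union> {q n} \<union>
    (nearby (E n) (chain E q n) \<union> nearby (uminus ` E n) (chain E q n))"

lemma submetrizable_k_omega:
  assumes sep: "separable_space X" and ne: "topspace X \<noteq> {}"
    and \<alpha>: "\<And>k. seq_rel_compact (free_top X) (D (map \<alpha> [0..<k]) \<inter> differences)"
  shows "submetrizable_space X \<and> k_omega_space X"
proof -
  obtain Q where Q: "countable Q" "Q \<subseteq> topspace X" "X closure_of Q = topspace X"
    using sep unfolding separable_space_def by blast
  have "Q \<noteq> {}" using Q(3) ne by (metis closure_of_empty)
  then have rq: "range (from_nat_into Q) = Q" using Q(1) by (rule range_from_nat_into)
  define E where "E n = D (map \<alpha> [0..<n]) \<inter> differences" for n
  define P where "P = chain E (from_nat_into Q)"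
  define K where "K n = X closure_of P n" for n
  have E_mono: "E m \<subseteq> E n" if "m \<le> n" for m n
    unfolding E_def using D_mono[OF that] by blast
  have q_in: "from_nat_into Q n \<in> topspace X" for n using rq Q(2) by blast
  have P_Suc: "P n \<subseteq> P (Suc n)" for n unfolding P_def by auto
  have P_mono: "P m \<subseteq> P n" if "m \<le> n" for m n by (rule lift_Suc_mono_le[of P, OF P_Suc that])
  have PX: "P n \<subseteq> topspace X" for n
    unfolding P_def by (induction n) (auto simp: q_in nearby_def)
  have P_rc: "seq_rel_compact X (P n)" for n
  proof (induction n)
    case 0
    show ?case by (rule compactin_imp_seq_rel_compact[of X "{}"]) (auto simp: P_def)
  next
    case (Suc n)
    have E: "seq_rel_compact (free_top X) (E n)" unfolding E_def by (rule \<alpha>)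
    have "seq_rel_compact X {from_nat_into Q n}"
      by (rule compactin_imp_seq_rel_compact[of X "{from_nat_into Q n}"]) (auto simp: q_in)
    then have "seq_rel_compact X (P n \<union> {from_nat_into Q n} \<union>
        (nearby (E n) (P n) \<union> nearby (uminus ` E n) (P n)))"
      by (intro seq_rel_compact_Un Suc seq_rel_compact_nearby E seq_rel_compact_image[OF E A.neg])
    then show ?case unfolding P_def by simp
  qed
  have "\<exists>F. approximated_set X (P n) F" for n
    using approximated_set[OF PX P_rc, of n] by blast
  then have "\<exists>F. \<forall>n. approximated_set X (P n) (F n)" by (intro choice allI)
  then obtain F where F: "\<And>n. approximated_set X (P n) (F n)" by blast
  have PK: "P n \<subseteq> K n" for n unfolding K_def by (rule closure_of_subset[OF PX])
  have K_mono: "K m \<subseteq> K n" if "m \<le> n" for m n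
    unfolding K_def by (rule closure_of_mono[OF P_mono[OF that]])
  \<comment> \<open>The link between convergence and \<open>\<alpha>\<close>: a tail of
    \<open>z\<close> differs from its limit by elements of a single \<open>E k\<close>.\<close>
  have near: "\<exists>k m. \<forall>i\<ge>m. e (z i) - e l \<in> E k"
    if z: "\<And>i. z i \<in> topspace X" "limitin X z l sequentially" for z :: "nat \<Rightarrow> 'a" and l
  proof -
    have "limitin (free_top X) (\<lambda>i. e (z i) - e l) 0 sequentially"
      using limitin_e_diff[OF z(2), of 1] by (simp only: of_nat_1 mult_1)
    then have "\<exists>k m. \<forall>i\<ge>m. e (z i) - e l \<in> D (map \<alpha> [0..<k])"
    proof (rule eventually_in_D[where \<alpha> = \<alpha>])
      fix k m assume "\<And>i. m \<le> i \<Longrightarrow> e (z i) - e l \<in> D (map \<alpha> [0..<k])"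
      then show "\<exists>k m. \<forall>i\<ge>m. e (z i) - e l \<in> D (map \<alpha> [0..<k])" by blast
    qed
    then obtain k m where km: "\<forall>i\<ge>m. e (z i) - e l \<in> D (map \<alpha> [0..<k])" by blast
    have "e (z i) - e l \<in> differences" for i
      unfolding differences_def
      by (rule image_eqI[of _ _ "(z i, l)"]) (use z(1) limitin_topspace[OF z(2)] in auto)
    then show ?thesis unfolding E_def using km by blast
  qed
  have step1: "x \<in> P (Suc n)" if "x \<in> topspace X" "y \<in> P n" "e x - e y \<in> E n" for x y n
    using that unfolding P_def chain.simps nearby_def by blast
  have step2: "x \<in> P (Suc n)" if "x \<in> topspace X" "y \<in> P n" "e y - e x \<in> E n" for x y n
  proof -
    have "e x - e y \<in> uminus ` E n" by (rule image_eqI[OF _ that(3)]) simp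
    then show ?thesis using that(1,2) unfolding P_def chain.simps nearby_def by blast
  qed
  \<comment> \<open>The union contains the dense set \<open>Q\<close>, and \<open>step2\<close>
    makes it sequentially closed.\<close>
  have Union_P: "(\<Union>n. P n) = topspace X"
  proof
    show "(\<Union>n. P n) \<subseteq> topspace X" using PX by blast
    have "closedin X (\<Union>n. P n)"
    proof (rule closedin_sequentiallyI)
      show "(\<Union>n. P n) \<subseteq> topspace X" using PX by blast
      fix z :: "nat \<Rightarrow> 'a" and l
      assume z: "\<And>n. z n \<in> (\<Union>n. P n)" "limitin X z l sequentially"
      have "z n \<in> topspace X" for n using z(1) PX by blast
      from near[of z, OF this z(2)] obtain k m where km: "\<And>i. i \<ge> m \<Longrightarrow> e (z i) - e l \<in> E k"
        by blast
      obtain n where n: "z m \<in> P n" using z(1) by blast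
      have "e (z m) - e l \<in> E (max k n)" using km[of m] E_mono[of k "max k n"] by auto
      moreover have "z m \<in> P (max k n)" using n P_mono[of n "max k n"] by auto
      ultimately have "l \<in> P (Suc (max k n))"
        by (intro step2[OF limitin_topspace[OF z(2)]])
      then show "l \<in> (\<Union>n. P n)" by blast
    qed
    moreover have "Q \<subseteq> (\<Union>n. P n)"
    proof
      fix x assume "x \<in> Q"
      then obtain n where "x = from_nat_into Q n" using rq by blast
      then have "x \<in> P (Suc n)" unfolding P_def by simp
      then show "x \<in> (\<Union>n. P n)" by blast
    qed
    ultimately have "X closure_of Q \<subseteq> (\<Union>n. P n)" by (intro closure_of_minimal)
    then show "topspace X \<subseteq> (\<Union>n. P n)" using Q(3) by simp
  qed
  have KX: "K n \<subseteq> topspace X" for n unfolding K_def by (rule closure_of_subset_topspace)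
  have Union_K: "(\<Union>n. K n) = topspace X"
  proof
    show "(\<Union>n. K n) \<subseteq> topspace X" by (rule UN_least[OF KX])
    show "topspace X \<subseteq> (\<Union>n. K n)"
      unfolding Union_P[symmetric] by (rule UN_mono[OF subset_refl PK])
  qed
  have "submetrizable_space X"
  proof (rule submetrizable_space_countable_family[of "\<Union>n. F n"])
    show "countable (\<Union>n. F n)" using F unfolding approximated_set_def by blast
    show "continuous_map X euclideanreal g" if "g \<in> (\<Union>n. F n)" for g
      using that F unfolding approximated_set_def by blast
    fix x y assume xy: "x \<in> topspace X" "y \<in> topspace X" "x \<noteq> y"
    obtain i j where "x \<in> K i" "y \<in> K j" using xy Union_K by blast
    then have "x \<in> K (max i j)" "y \<in> K (max i j)"
      using K_mono[of i "max i j"] K_mono[of j "max i j"] by auto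
    then obtain g where "g \<in> F (max i j)" "g x \<noteq> g y"
      using approximated_set.separating[OF F[of "max i j"], of x y] xy(3) unfolding K_def by metis
    then show "\<exists>g\<in>\<Union>n. F n. g x \<noteq> g y" by blast
  qed
  moreover have "k_omega_space X"
    unfolding k_omega_space_def
  proof (intro exI[of _ K] conjI allI impI)
    show "compactin X (K n)" for n
      unfolding K_def by (rule approximated_set.compactin_closure[OF F])
    show "K n \<subseteq> K (Suc n)" for n by (rule K_mono) simp
    show "(\<Union>n. K n) = topspace X" by (rule Union_K)
    fix S assume S: "S \<subseteq> topspace X"
    show "closedin X S \<longleftrightarrow> (\<forall>n. closedin (subtopology X (K n)) (K n \<inter> S))"
    proof
      show "\<forall>n. closedin (subtopology X (K n)) (K n \<inter> S)" if "closedin X S"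
        using that closedin_subtopology by (metis inf_commute)
      assume K_S: "\<forall>n. closedin (subtopology X (K n)) (K n \<inter> S)"
      have closed: "closedin X (K n \<inter> S)" for n
        using closedin_trans_full[of X "K n" "K n \<inter> S"] K_S unfolding K_def by simp
      show "closedin X S"
      \<comment> \<open>The limit already lies in some \<open>P n\<close>. By \<open>near\<close>
        and \<open>step1\<close> a tail of the sequence lies in one later \<open>K\<close>, on which
        the trace of \<open>S\<close> is closed.\<close>
      proof (rule closedin_sequentiallyI[OF S])
        fix z :: "nat \<Rightarrow> 'a" and l
        assume z: "\<And>n. z n \<in> S" "limitin X z l sequentially"
        have zX: "z n \<in> topspace X" for n using z(1) S by blast
        from near[of z, OF zX z(2)] obtain k m where km: "\<And>i. i \<ge> m \<Longrightarrow> e (z i) - e l \<in> E k"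
          by blast
        obtain n where n: "l \<in> P n" using limitin_topspace[OF z(2)] Union_P by blast
        let ?n = "max k n"
        have l: "l \<in> P ?n" using n P_mono[of n ?n] by auto
        have "z i \<in> K (Suc ?n) \<inter> S" if "i \<ge> m" for i
        proof -
          have "e (z i) - e l \<in> E ?n" using km[OF that] E_mono[of k ?n] by auto
          then have "z i \<in> P (Suc ?n)" by (rule step1[OF zX l])
          then show ?thesis using PK z(1) by blast
        qed
        then have "\<forall>\<^sub>F i in sequentially. z i \<in> K (Suc ?n) \<inter> S"
          unfolding eventually_sequentially by blast
        then have "l \<in> K (Suc ?n) \<inter> S"
          using limitin_closedin[OF z(2) closed] by simp
        then show "l \<in> S" by blast
      qed
    qed
  qed
  ultimately show ?thesis by blast
qed

text \<open>If \<open>l\<close> is not isolated, \<open>topspace X - {l}\<close> is not closed.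
  Sequentiality turns this into a sequence of points other than \<open>l\<close> converging to
  \<open>l\<close>, from which \<open>exists_small_differences\<close> produces
  \<open>\<alpha>\<close>.\<close>

lemma discrete_or_submetrizable_k_omega:
  assumes sep: "separable_space X"
  shows "(countable (topspace X) \<and> X = discrete_topology (topspace X)) \<or>
    (submetrizable_space X \<and> k_omega_space X)"
proof (cases "\<forall>l\<in>topspace X. openin X {l}")
  case True
  then have X: "X = discrete_topology (topspace X)" using discrete_topology_unique by metis
  obtain Q where Q: "countable Q" "Q \<subseteq> topspace X" "X closure_of Q = topspace X"
    using sep unfolding separable_space_def by blast
  have "X closure_of Q = topspace X \<inter> Q" using X discrete_topology_closure_of by metis
  then have "countable (topspace X)" using Q by (simp add: Int_absorb1)
  with X show ?thesis by blast
next
  case False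
  then obtain l where l: "l \<in> topspace X" "\<not> openin X {l}" by blast
  have "topspace X - (topspace X - {l}) = {l}" using l(1) by blast
  then have "\<not> closedin X (topspace X - {l})" using l(2) unfolding closedin_def by simp
  then have "\<exists>z m. (\<forall>n. z n \<in> topspace X - {l}) \<and> limitin X z m sequentially \<and> m \<notin> topspace X - {l}"
    using closedin_sequentiallyI[of "topspace X - {l}"] by blast
  then obtain z m where z: "\<And>n. z n \<in> topspace X - {l}" "limitin X z m sequentially"
    "m \<notin> topspace X - {l}" by blast
  have "m = l" using limitin_topspace[OF z(2)] z(3) by blast
  then obtain \<alpha> where "\<And>k. seq_rel_compact (free_top X) (D (map \<alpha> [0..<k]) \<inter> differences)"
    using exists_small_differences[of z l] z(1,2) by blast
  moreover have "topspace X \<noteq> {}" using l(1) by blast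
  ultimately show ?thesis using submetrizable_k_omega[OF sep, of \<alpha>] by blast
qed

end

section \<open>Countable discrete spaces and the equivalence\<close>

lemma countable_discrete_imp_submetrizable_k_omega:
  assumes "countable (topspace X)" "X = discrete_topology (topspace X)"
  shows "submetrizable_space X \<and> k_omega_space X"
proof
  have "metrizable_space X" by (metis assms(2) metrizable_space_discrete_topology)
  then show "submetrizable_space X" unfolding submetrizable_space_def by blast
  have closed: "closedin X S" if "S \<subseteq> topspace X" for S
    using that closedin_discrete_topology assms(2) by metis
  \<comment> \<open>Finite initial segments of an enumeration; in a discrete space every set and
    every trace is closed.\<close>
  define K where "K n = {x \<in> topspace X. to_nat_on (topspace X) x \<le> n}" for n
  have "finite (K n)" for n
  proof (rule finite_imageD)
    show "finite (to_nat_on (topspace X) ` K n)"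
      by (rule finite_subset[of _ "{..n}"]) (auto simp: K_def)
    show "inj_on (to_nat_on (topspace X)) (K n)"
      by (rule inj_on_subset[OF inj_on_to_nat_on[OF assms(1)]]) (auto simp: K_def)
  qed
  then have "compactin X (K n)" for n by (rule finite_imp_compactin[rotated]) (auto simp: K_def)
  moreover have "(\<Union>n. K n) = topspace X" by (auto simp: K_def)
  moreover have "closedin (subtopology X (K n)) (K n \<inter> S)" if "S \<subseteq> topspace X" for S n
    using closedin_subtopology_Int_closed[OF closed[OF that]] by simp
  ultimately show "k_omega_space X"
    unfolding k_omega_space_def using closed by (intro exI[of _ K]) (auto simp: K_def)
qed

theorem theorem4p6:
  fixes X :: "'a topology"
  assumes "separable_space X" and "tychonoff_space X"
  shows "(k_space (free_abelian_topological_group X) \<and> free_ab_has_G_base X) \<longleftrightarrow>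
         ((countable (topspace X) \<and> X = discrete_topology (topspace X)) \<or>
          (submetrizable_space X \<and> k_omega_space X))"
proof
  assume L: "k_space (free_top X) \<and> free_ab_has_G_base X"
  then have "has_G_base_at (free_top X) (0 :: 'a \<Rightarrow> int)"
    unfolding free_ab_has_G_base_def zero_fun_def by blast
  then obtain U :: "(nat \<Rightarrow> nat) \<Rightarrow> ('a \<Rightarrow> int) set" where U:
    "\<forall>\<alpha>. U \<alpha> \<subseteq> topspace (free_top X) \<and> (\<exists>V. openin (free_top X) V \<and> 0 \<in> V \<and> V \<subseteq> U \<alpha>)"
    "\<forall>W. openin (free_top X) W \<and> 0 \<in> W \<longrightarrow> (\<exists>\<alpha>. U \<alpha> \<subseteq> W)"
    "\<forall>\<alpha> \<beta>. (\<forall>i. \<alpha> i \<le> \<beta> i) \<longrightarrow> U \<beta> \<subseteq> U \<alpha>"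
    unfolding has_G_base_at_def by (elim exE conjE)
  interpret k_space_G_base X U
    by unfold_locales (use assms L U in simp_all)
  show "(countable (topspace X) \<and> X = discrete_topology (topspace X)) \<or>
    (submetrizable_space X \<and> k_omega_space X)"
    by (rule discrete_or_submetrizable_k_omega[OF assms(1)])
next
  assume "(countable (topspace X) \<and> X = discrete_topology (topspace X)) \<or>
    (submetrizable_space X \<and> k_omega_space X)"
  then have "submetrizable_space X \<and> k_omega_space X"
    using countable_discrete_imp_submetrizable_k_omega by blast
  then show "k_space (free_top X) \<and> free_ab_has_G_base X"
    using k_omega_submetrizable_imp[OF assms] by blast
qed

end
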